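(* Let $\Delta$ be an infinite additive subgroup of $\mathbb{C}$, let $b\in\mathbb{C}$ with $2b\notin\Delta$, and let $\varphi:\Delta\to\mathbb{C}^+$ be a group homomorphism. Then $CL(b,\varphi)$ does not have a non-trivial representation on any finite $\mathbb{C}[\partial]$-module; that is, for every $CL(b,\varphi)$-module $V$ that is finitely generated over $\mathbb{C}[\partial]$ one has $a_\lambda v=0$ for all $a\in CL(b,\varphi)$ and $v\in V$.
   Context: $\mathbb{C}^+$ is the additive group of $\mathbb{C}$. A Lie conformal algebra $R$ is a $\mathbb{C}[\partial]$-module with a $\mathbb{C}$-bilinear map ($\lambda$-bracket) $R\times R\to R[\lambda]$, $(a,b)\mapsto[a_\lambda b]$, satisfying $[\partial a_\lambda b]=-\lambda[a_\lambda b]$, $[a_\lambda\partial b]=(\lambda+\partial)[a_\lambda b]$, $[a_\lambda b]=-[b_{-\lambda-\partial}a]$ and $[a_\lambda[b_\mu c]]=[[a_\lambda b]_{\lambda+\mu}c]+[b_\mu[a_\lambda c]]$ for all $a,b,c\in R$. $CL(b,\varphi)=\bigoplus_{\alpha\in\Delta}\mathbb{C}[\partial]x_\alpha$ is the Lie conformal algebra which is free as a $\mathbb{C}[\partial]$-module on $\{x_\alpha\}_{\alpha\in\Delta}$, with $$[{x_\alpha}_\lambda x_\beta]=\big((\alpha+b)\partial+(\alpha+\beta+2b)\lambda\big)x_{\alpha+\beta}+\tfrac1b\big(\varphi(\alpha)\beta-\varphi(\beta)\alpha+b(\varphi(\alpha)-\varphi(\beta))\big)x_{\alpha+\beta}.$$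 A module (representation) $M$ over a Lie conformal algebra $R$ is a $\mathbb{C}[\partial]$-module with a $\mathbb{C}$-bilinear map $R\times M\to M[\lambda]$, $(a,v)\mapsto a_\lambda v$, such that $(\partial a)_\lambda v=-\lambda a_\lambda v$, $a_\lambda(\partial v)=(\partial+\lambda)a_\lambda v$ and $[a_\lambda b]_{\lambda+\mu}v=a_\lambda(b_\mu v)-b_\mu(a_\lambda v)$ for all $a,b\in R$, $v\in M$. *)

theory Defs
  imports Complex_Main "HOL-Library.Poly_Mapping" "HOL-Computational_Algebra.Polynomial"
begin

section \<open>Lie conformal algebras and their modules\<close>

text \<open>
  The ring \<open>\<complex>[\<partial>]\<close> is \<^typ>\<open>complex poly\<close>; a \<open>\<complex>[\<partial>]\<close>-module is an instance of the locale
  \<^locale>\<open>module\<close>, and \<open>\<partial>\<close> acts as the scalar \<^term>\<open>[:0, 1:] :: complex poly\<close>.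
  For an abelian group \<open>'m\<close>, the group \<open>M[\<lambda>]\<close> is \<open>'m poly\<close>. Multiplication by \<open>\<lambda>\<close> is
  \<^term>\<open>pCons 0\<close>, and an operator on \<open>M\<close> acts on \<open>M[\<lambda>]\<close> coefficientwise via \<^const>\<open>map_poly\<close>.
  Polynomials in two variables, \<open>M[\<lambda>,\<mu>] = (M[\<lambda>])[\<mu>]\<close>, are \<open>'m poly poly\<close>, the outer variable
  being \<open>\<mu>\<close>.
\<close>

text \<open>
  \<open>\<Sum>\<^sub>n T\<^sup>n (\<iota> c\<^sub>n)\<close> for \<open>P = \<Sum>\<^sub>n \<lambda>\<^sup>n c\<^sub>n\<close>: replace the variable by the operator \<open>T\<close>, after
  transporting the coefficients by \<open>\<iota>\<close>.
\<close>
definition poly_subst :: "('a::zero \<Rightarrow> 'b::ab_group_add) \<Rightarrow> ('b \<Rightarrow> 'b) \<Rightarrow> 'a poly \<Rightarrow> 'b" where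
  "poly_subst \<iota> T P = (\<Sum>n\<le>degree P. (T ^^ n) (\<iota> (coeff P n)))"

text \<open>\<open>P(-\<lambda>-\<partial>)\<close>, with the powers of \<open>-\<lambda>-\<partial>\<close> applied to the coefficients from the left.\<close>
definition subst_skew :: "('m::ab_group_add \<Rightarrow> 'm) \<Rightarrow> 'm poly \<Rightarrow> 'm poly" where
  "subst_skew D P = poly_subst (\<lambda>c. [:c:]) (\<lambda>Q. - pCons 0 Q - map_poly D Q) P"

text \<open>\<open>P(\<lambda>+\<mu>)\<close> in \<open>M[\<lambda>,\<mu>]\<close>.\<close>
definition subst_sum :: "'m::ab_group_add poly \<Rightarrow> 'm poly poly" where
  "subst_sum P = poly_subst (\<lambda>c. [:[:c:]:]) (\<lambda>Q. map_poly (pCons 0) Q + pCons 0 Q) P"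

text \<open>Exchange of the two variables.\<close>
definition poly_swap :: "'m::ab_group_add poly poly \<Rightarrow> 'm poly poly" where
  "poly_swap P = poly_subst (map_poly (\<lambda>c. [:c:])) (map_poly (pCons 0)) P"

text \<open>
  For \<open>f\<close> a bracket or an action, written \<open>x\<^sub>\<lambda> y = f x y\<close>, the elements \<open>a\<^sub>\<lambda>(b\<^sub>\<mu> v)\<close> and
  \<open>b\<^sub>\<mu>(a\<^sub>\<lambda> v)\<close> of \<open>M[\<lambda>,\<mu>]\<close>, and \<open>P\<^bsub>\<lambda>+\<mu>\<^esub> v = \<Sum>\<^sub>n \<lambda>\<^sup>n ((c\<^sub>n)\<^bsub>\<lambda>+\<mu>\<^esub> v)\<close> for
  \<open>P = \<Sum>\<^sub>n \<lambda>\<^sup>n c\<^sub>n\<close> in \<open>R[\<lambda>]\<close>.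
\<close>
definition lam_mu :: "('r \<Rightarrow> 'm::ab_group_add \<Rightarrow> 'm poly) \<Rightarrow> 'r \<Rightarrow> 'r \<Rightarrow> 'm \<Rightarrow> 'm poly poly" where
  "lam_mu f a b v = map_poly (f a) (f b v)"

definition mu_lam :: "('r \<Rightarrow> 'm::ab_group_add \<Rightarrow> 'm poly) \<Rightarrow> 'r \<Rightarrow> 'r \<Rightarrow> 'm \<Rightarrow> 'm poly poly" where
  "mu_lam f b a v = poly_swap (map_poly (f b) (f a v))"

definition lam_plus_mu ::
    "('r::zero \<Rightarrow> 'm::ab_group_add \<Rightarrow> 'm poly) \<Rightarrow> 'r poly \<Rightarrow> 'm \<Rightarrow> 'm poly poly" where
  "lam_plus_mu f P v = poly_subst (\<lambda>c. subst_sum (f c v)) (map_poly (pCons 0)) P"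

text \<open>
  The algebra is a \<open>\<complex>[\<partial>]\<close>-submodule \<open>R\<close> of a module given by a type; this is needed because
  the basis of \<open>CL(b,\<phi>)\<close> is indexed by a subset of \<open>\<complex>\<close>.
\<close>
locale lie_conformal_algebra = module scale
  for scale :: "complex poly \<Rightarrow> 'r::ab_group_add \<Rightarrow> 'r" +
  fixes R :: "'r set" and br :: "'r \<Rightarrow> 'r \<Rightarrow> 'r poly"
  assumes submodule: "subspace R"
    and br_closed: "a \<in> R \<Longrightarrow> b \<in> R \<Longrightarrow> coeff (br a b) n \<in> R"
    and br_add_left: "a \<in> R \<Longrightarrow> a' \<in> R \<Longrightarrow> b \<in> R \<Longrightarrow> br (a + a') b = br a b + br a' b"
    and br_add_right: "a \<in> R \<Longrightarrow> b \<in> R \<Longrightarrow> b' \<in> R \<Longrightarrow> br a (b + b') = br a b + br a b'"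
    and br_scale_left:
      "a \<in> R \<Longrightarrow> b \<in> R \<Longrightarrow> br (scale [:k:] a) b = map_poly (scale [:k:]) (br a b)"
    and br_scale_right:
      "a \<in> R \<Longrightarrow> b \<in> R \<Longrightarrow> br a (scale [:k:] b) = map_poly (scale [:k:]) (br a b)"
    and br_partial_left:
      "a \<in> R \<Longrightarrow> b \<in> R \<Longrightarrow> br (scale [:0, 1:] a) b = - pCons 0 (br a b)"
    and br_partial_right:
      "a \<in> R \<Longrightarrow> b \<in> R \<Longrightarrow>
        br a (scale [:0, 1:] b) = pCons 0 (br a b) + map_poly (scale [:0, 1:]) (br a b)"
    and br_skew: "a \<in> R \<Longrightarrow> b \<in> R \<Longrightarrow> br a b = - subst_skew (scale [:0, 1:]) (br b a)"
    and br_jacobi: "a \<in> R \<Longrightarrow> b \<in> R \<Longrightarrow> c \<in> R \<Longrightarrow>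
        lam_mu br a b c = lam_plus_mu br (br a b) c + mu_lam br b a c"

locale lie_conformal_module =
  lie_conformal_algebra scale R br + V: module scaleV
  for scale :: "complex poly \<Rightarrow> 'r::ab_group_add \<Rightarrow> 'r" and R br
    and scaleV :: "complex poly \<Rightarrow> 'v::ab_group_add \<Rightarrow> 'v" +
  fixes act :: "'r \<Rightarrow> 'v \<Rightarrow> 'v poly"
  assumes act_add_left: "a \<in> R \<Longrightarrow> a' \<in> R \<Longrightarrow> act (a + a') v = act a v + act a' v"
    and act_add_right: "a \<in> R \<Longrightarrow> act a (v + v') = act a v + act a v'"
    and act_scale_left: "a \<in> R \<Longrightarrow> act (scale [:k:] a) v = map_poly (scaleV [:k:]) (act a v)"
    and act_scale_right: "a \<in> R \<Longrightarrow> act a (scaleV [:k:] v) = map_poly (scaleV [:k:]) (act a v)"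
    and act_partial_left: "a \<in> R \<Longrightarrow> act (scale [:0, 1:] a) v = - pCons 0 (act a v)"
    and act_partial_right: "a \<in> R \<Longrightarrow>
        act a (scaleV [:0, 1:] v) = map_poly (scaleV [:0, 1:]) (act a v) + pCons 0 (act a v)"
    and act_bracket: "a \<in> R \<Longrightarrow> b \<in> R \<Longrightarrow>
        lam_plus_mu act (br a b) v = lam_mu act a b v - mu_lam act b a v"


section \<open>The Lie conformal algebra \<open>CL(b,\<phi>)\<close>\<close>

text \<open>
  The free \<open>\<complex>[\<partial>]\<close>-module on \<open>\<Delta>\<close> consists of the finitely supported functions
  \<open>\<complex> \<Rightarrow>\<^sub>0 \<complex>[\<partial>]\<close> with support in \<open>\<Delta>\<close>; the basis element \<open>x\<^sub>\<alpha>\<close> is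
  \<^term>\<open>Poly_Mapping.single \<alpha> (1 :: complex poly)\<close>.
\<close>
type_synonym cl = "complex \<Rightarrow>\<^sub>0 complex poly"

definition CL_carrier :: "complex set \<Rightarrow> cl set" where
  "CL_carrier \<Delta> = {f. Poly_Mapping.keys f \<subseteq> \<Delta>}"

definition CL_scale :: "complex poly \<Rightarrow> cl \<Rightarrow> cl" where
  "CL_scale p f = Poly_Mapping.map ((*) p) f"

text \<open>
  The coefficient of \<open>x\<^bsub>\<alpha>+\<beta>\<^esub>\<close> in \<open>[x\<^sub>\<alpha> \<^sub>\<lambda> x\<^sub>\<beta>]\<close>, as an element of \<open>\<complex>[\<partial>][\<lambda>]\<close>.
\<close>
definition CL_coeff :: "complex \<Rightarrow> (complex \<Rightarrow> complex) \<Rightarrow> complex \<Rightarrow> complex \<Rightarrow> complex poly poly" where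
  "CL_coeff b \<phi> \<alpha> \<beta> =
     [: [: (1 / b) * (\<phi> \<alpha> * \<beta> - \<phi> \<beta> * \<alpha> + b * (\<phi> \<alpha> - \<phi> \<beta>)), \<alpha> + b :], [: \<alpha> + \<beta> + 2 * b :] :]"

text \<open>\<open>p(-\<lambda>)\<close> and \<open>q(\<lambda>+\<partial>)\<close> as elements of \<open>\<complex>[\<partial>][\<lambda>]\<close>, for \<open>p\<close>, \<open>q\<close> in \<open>\<complex>[\<partial>]\<close>.\<close>
definition at_minus_lam :: "complex poly \<Rightarrow> complex poly poly" where
  "at_minus_lam p = poly (map_poly (\<lambda>c. [:[:c:]:]) p) [:0, -1:]"

definition at_lam_plus_partial :: "complex poly \<Rightarrow> complex poly poly" where
  "at_lam_plus_partial q = poly (map_poly (\<lambda>c. [:[:c:]:]) q) [:[:0, 1:], 1:]"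

text \<open>
  The bracket of the basis elements extends to the free module in exactly one way compatible
  with \<open>[\<partial>a\<^sub>\<lambda> b] = -\<lambda>[a\<^sub>\<lambda> b]\<close> and \<open>[a\<^sub>\<lambda> \<partial>b] = (\<lambda>+\<partial>)[a\<^sub>\<lambda> b]\<close>, namely by
  \<open>[p(\<partial>)x\<^sub>\<alpha> \<^sub>\<lambda> q(\<partial>)x\<^sub>\<beta>] = p(-\<lambda>) q(\<lambda>+\<partial>) [x\<^sub>\<alpha> \<^sub>\<lambda> x\<^sub>\<beta>]\<close>.
\<close>
definition CL_bracket :: "complex \<Rightarrow> (complex \<Rightarrow> complex) \<Rightarrow> cl \<Rightarrow> cl \<Rightarrow> cl poly" where
  "CL_bracket b \<phi> f g =
     (\<Sum>\<alpha>\<in>Poly_Mapping.keys f. \<Sum>\<beta>\<in>Poly_Mapping.keys g.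
        map_poly (Poly_Mapping.single (\<alpha> + \<beta>))
          (at_minus_lam (Poly_Mapping.lookup f \<alpha>) * at_lam_plus_partial (Poly_Mapping.lookup g \<beta>)
            * CL_coeff b \<phi> \<alpha> \<beta>))"

lemma CL_bracket_basis:
  "CL_bracket b \<phi> (Poly_Mapping.single \<alpha> 1) (Poly_Mapping.single \<beta> 1) =
    [: Poly_Mapping.single (\<alpha> + \<beta>)
         [: (1 / b) * (\<phi> \<alpha> * \<beta> - \<phi> \<beta> * \<alpha> + b * (\<phi> \<alpha> - \<phi> \<beta>)), \<alpha> + b :],
       Poly_Mapping.single (\<alpha> + \<beta>) [: \<alpha> + \<beta> + 2 * b :] :]"
proof -
  have "at_minus_lam 1 = 1" "at_lam_plus_partial 1 = 1"
    by (simp_all add: at_minus_lam_def at_lam_plus_partial_def map_poly_pCons one_pCons)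
  then show ?thesis
    by (simp add: CL_bracket_def CL_coeff_def map_poly_pCons)
qed

section \<open>\<open>CL(b,\<phi>)\<close> is a Lie conformal algebra\<close>

text \<open>
  Elements of \<open>R\<close>, \<open>R[\<lambda>]\<close> and \<open>R[\<lambda>,\<mu>]\<close> are compared through the values of their
  \<open>x\<^sub>\<gamma>\<close>-components at complex numbers \<open>\<partial> = d\<close>, \<open>\<lambda> = l\<close>, \<open>\<mu> = m\<close>.
\<close>

definition ev0 :: "complex \<Rightarrow> complex \<Rightarrow> cl \<Rightarrow> complex" where
  "ev0 \<gamma> d f = poly (Poly_Mapping.lookup f \<gamma>) d"

definition ev1 :: "complex \<Rightarrow> complex \<Rightarrow> complex \<Rightarrow> cl poly \<Rightarrow> complex" where
  "ev1 \<gamma> d l P = poly (map_poly (ev0 \<gamma> d) P) l"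

definition ev2 :: "complex \<Rightarrow> complex \<Rightarrow> complex \<Rightarrow> complex \<Rightarrow> cl poly poly \<Rightarrow> complex" where
  "ev2 \<gamma> d l m X = poly (map_poly (ev1 \<gamma> d l) X) m"

lemma map_poly_additive:
  assumes "additive h"
  shows "map_poly h (P + Q) = map_poly h P + map_poly h Q"
  using assms by (intro poly_eqI) (simp add: coeff_map_poly additive.zero additive.add)

lemma poly_map_poly_additive:
  fixes h :: "'a::ab_group_add \<Rightarrow> complex"
  assumes "additive h"
  shows "additive (\<lambda>P. poly (map_poly h P) x)"
  by unfold_locales (simp add: map_poly_additive[OF assms])

lemma poly_map_poly_fun_add:
  fixes g h :: "'a::ab_group_add \<Rightarrow> complex"
  assumes "g 0 = 0" "h 0 = 0"
  shows "poly (map_poly (\<lambda>c. g c + h c) P) x = poly (map_poly g P) x + poly (map_poly h P) x"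
proof -
  have "map_poly (\<lambda>c. g c + h c) P = map_poly g P + map_poly h P"
    using assms by (intro poly_eqI) (simp add: coeff_map_poly)
  then show ?thesis by simp
qed

lemma poly_map_poly_sum:
  fixes g :: "'a::zero \<Rightarrow> complex"
  assumes "g 0 = 0"
  shows "poly (map_poly g P) x = (\<Sum>n\<le>degree P. g (coeff P n) * x ^ n)"
proof -
  have "degree (map_poly g P) \<le> degree P"
    using assms by (intro degree_le) (simp add: coeff_map_poly coeff_eq_0)
  then have "(\<Sum>n\<le>degree P. coeff (map_poly g P) n * x ^ n)
      = (\<Sum>n\<le>degree (map_poly g P). coeff (map_poly g P) n * x ^ n)"
    by (intro sum.mono_neutral_right) (auto simp: coeff_eq_0)
  then show ?thesis
    using assms by (simp add: poly_altdef coeff_map_poly)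
qed

lemma additive_ev0: "additive (ev0 \<gamma> d)"
  by unfold_locales (simp add: ev0_def lookup_add)

lemma additive_ev1: "additive (ev1 \<gamma> d l)"
  using poly_map_poly_additive[OF additive_ev0] by (simp add: ev1_def[abs_def])

lemma additive_ev2: "additive (ev2 \<gamma> d l m)"
  using poly_map_poly_additive[OF additive_ev1] by (simp add: ev2_def[abs_def])

lemmas ev0_add = additive.add[OF additive_ev0] and ev0_zero [simp] = additive.zero[OF additive_ev0]
lemmas ev1_add = additive.add[OF additive_ev1] and ev1_zero [simp] = additive.zero[OF additive_ev1]
  and ev1_minus = additive.minus[OF additive_ev1] and ev1_diff = additive.diff[OF additive_ev1]
  and ev1_sum = additive.sum[OF additive_ev1]
lemmas ev2_add = additive.add[OF additive_ev2] and ev2_zero [simp] = additive.zero[OF additive_ev2]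

lemma ev0_eqI: "(\<And>\<gamma> d. ev0 \<gamma> d f = ev0 \<gamma> d g) \<Longrightarrow> f = g"
  by (intro poly_mapping_eqI) (simp add: ev0_def flip: poly_eq_poly_eq_iff add: fun_eq_iff)

lemma ev1_eqI:
  assumes "\<And>\<gamma> d l. ev1 \<gamma> d l P = ev1 \<gamma> d l Q"
  shows "P = Q"
proof (rule poly_eqI, rule ev0_eqI)
  fix n \<gamma> d
  have "map_poly (ev0 \<gamma> d) P = map_poly (ev0 \<gamma> d) Q"
    using assms by (simp add: ev1_def flip: poly_eq_poly_eq_iff add: fun_eq_iff)
  then have "coeff (map_poly (ev0 \<gamma> d) P) n = coeff (map_poly (ev0 \<gamma> d) Q) n"
    by simp
  then show "ev0 \<gamma> d (coeff P n) = ev0 \<gamma> d (coeff Q n)"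
    by (simp add: coeff_map_poly)
qed

lemma ev2_eqI:
  assumes "\<And>\<gamma> d l m. ev2 \<gamma> d l m X = ev2 \<gamma> d l m Y"
  shows "X = Y"
proof (rule poly_eqI, rule ev1_eqI)
  fix n \<gamma> d l
  have "map_poly (ev1 \<gamma> d l) X = map_poly (ev1 \<gamma> d l) Y"
    using assms by (simp add: ev2_def flip: poly_eq_poly_eq_iff add: fun_eq_iff)
  then have "coeff (map_poly (ev1 \<gamma> d l) X) n = coeff (map_poly (ev1 \<gamma> d l) Y) n"
    by simp
  then show "ev1 \<gamma> d l (coeff X n) = ev1 \<gamma> d l (coeff Y n)"
    by (simp add: coeff_map_poly)
qed

lemma lookup_CL_scale: "Poly_Mapping.lookup (CL_scale p f) \<gamma> = p * Poly_Mapping.lookup f \<gamma>"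
  by (simp add: CL_scale_def Poly_Mapping.map.rep_eq when_def)

lemma ev0_CL_scale: "ev0 \<gamma> d (CL_scale p f) = poly p d * ev0 \<gamma> d f"
  by (simp add: ev0_def lookup_CL_scale)

lemma CL_scale_zero [simp]: "CL_scale p 0 = 0"
  by (rule ev0_eqI) (simp add: ev0_CL_scale)

lemma ev1_pCons: "ev1 \<gamma> d l (pCons f P) = ev0 \<gamma> d f + l * ev1 \<gamma> d l P"
  by (simp add: ev1_def map_poly_pCons)

lemma ev2_pCons: "ev2 \<gamma> d l m (pCons P X) = ev1 \<gamma> d l P + m * ev2 \<gamma> d l m X"
  by (simp add: ev2_def map_poly_pCons)

lemma ev1_map_poly_mult:
  assumes "h 0 = 0" "\<And>f. ev0 \<gamma> d (h f) = k * ev0 \<gamma> d f"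
  shows "ev1 \<gamma> d l (map_poly h P) = k * ev1 \<gamma> d l P"
proof (induction P)
  case 0
  show ?case by simp
next
  case (pCons c P)
  then show ?case by (simp add: map_poly_pCons assms ev1_pCons algebra_simps)
qed

lemmas ev1_map_poly_CL_scale = ev1_map_poly_mult[OF CL_scale_zero ev0_CL_scale]

lemma ev2_map_poly_pCons: "ev2 \<gamma> d l m (map_poly (pCons 0) X) = l * ev2 \<gamma> d l m X"
  by (induction X) (simp_all add: map_poly_pCons ev2_pCons ev1_pCons algebra_simps)

lemma ev_poly_subst:
  fixes h :: "'b::ab_group_add \<Rightarrow> complex"
  assumes h: "additive h" and T: "\<And>Q. h (T Q) = t * h Q" and i: "h (\<iota> 0) = 0"
  shows "h (poly_subst \<iota> T P) = poly (map_poly (\<lambda>c. h (\<iota> c)) P) t"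
proof -
  have "h ((T ^^ n) Q) = t ^ n * h Q" for n Q
    by (induction n) (simp_all add: T)
  then show ?thesis
    using i by (simp add: poly_subst_def additive.sum[OF h] poly_map_poly_sum mult.commute)
qed

lemma ev1_subst_skew: "ev1 \<gamma> d l (subst_skew (CL_scale [:0, 1:]) P) = ev1 \<gamma> d (- l - d) P"
  unfolding subst_skew_def
  by (subst ev_poly_subst[OF additive_ev1, where t = "- l - d"])
     (simp_all add: ev1_diff ev1_minus ev1_pCons ev1_map_poly_CL_scale algebra_simps
        ev1_def[of \<gamma> d "- l - d"])

lemma ev2_subst_sum: "ev2 \<gamma> d l m (subst_sum P) = ev1 \<gamma> d (l + m) P"
  unfolding subst_sum_def
  by (subst ev_poly_subst[OF additive_ev2, where t = "l + m"])
     (simp_all add: ev2_add ev2_map_poly_pCons ev2_pCons ev1_pCons algebra_simps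
        ev1_def[of \<gamma> d "l + m"])

lemma ev2_poly_swap: "ev2 \<gamma> d l m (poly_swap X) = ev2 \<gamma> d m l X"
proof -
  have "ev2 \<gamma> d l m (map_poly (\<lambda>c. [:c:]) P) = ev1 \<gamma> d m P" for P
    by (induction P) (simp_all add: map_poly_pCons ev2_pCons ev1_pCons)
  then show ?thesis
    unfolding poly_swap_def
    by (subst ev_poly_subst[OF additive_ev2, where t = l])
       (simp_all add: ev2_map_poly_pCons ev2_def[of \<gamma> d m l])
qed

lemma ev2_lam_mu:
  assumes "f a 0 = 0"
  shows "ev2 \<gamma> d l m (lam_mu f a b v) = poly (map_poly (\<lambda>c. ev1 \<gamma> d l (f a c)) (f b v)) m"
  using assms by (simp add: ev2_def lam_mu_def map_poly_map_poly o_def)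

lemma ev2_mu_lam:
  assumes "f b 0 = 0"
  shows "ev2 \<gamma> d l m (mu_lam f b a v) = poly (map_poly (\<lambda>c. ev1 \<gamma> d m (f b c)) (f a v)) l"
  unfolding mu_lam_def ev2_poly_swap using assms by (simp add: ev2_def map_poly_map_poly o_def)

lemma ev2_lam_plus_mu:
  assumes "f 0 v = 0"
  shows "ev2 \<gamma> d l m (lam_plus_mu f P v) = poly (map_poly (\<lambda>c. ev1 \<gamma> d (l + m) (f c v)) P) l"
  unfolding lam_plus_mu_def
  by (subst ev_poly_subst[OF additive_ev2, where t = l])
     (simp_all add: ev2_subst_sum ev2_map_poly_pCons assms)

lemma poly_map_poly_poly:
  fixes W :: "complex poly poly"
  shows "poly (map_poly (\<lambda>w. poly w x) W) m = poly (poly W [:m:]) x"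
  by (induction W) (simp_all add: map_poly_pCons)

definition CLc :: "complex \<Rightarrow> (complex \<Rightarrow> complex) \<Rightarrow> complex \<Rightarrow> complex \<Rightarrow> complex \<Rightarrow> complex \<Rightarrow> complex"
  where "CLc b \<phi> \<alpha> \<beta> d l = (\<alpha> + b) * d + (\<alpha> + \<beta> + 2 * b) * l
    + (1 / b) * (\<phi> \<alpha> * \<beta> - \<phi> \<beta> * \<alpha> + b * (\<phi> \<alpha> - \<phi> \<beta>))"

lemma poly_poly_CL_coeff: "poly (poly (CL_coeff b \<phi> \<alpha> \<beta>) [:l:]) d = CLc b \<phi> \<alpha> \<beta> d l"
  by (simp add: CL_coeff_def CLc_def algebra_simps)

lemma poly_poly_at_minus_lam: "poly (poly (at_minus_lam p) [:l:]) d = poly p (- l)"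
  by (induction p) (simp_all add: at_minus_lam_def map_poly_pCons)

lemma poly_poly_at_lam_plus_partial: "poly (poly (at_lam_plus_partial q) [:l:]) d = poly q (l + d)"
  by (induction q) (simp_all add: at_lam_plus_partial_def map_poly_pCons algebra_simps)

lemma at_minus_lam_0 [simp]: "at_minus_lam 0 = 0"
  and at_lam_plus_partial_0 [simp]: "at_lam_plus_partial 0 = 0"
  by (simp_all add: at_minus_lam_def at_lam_plus_partial_def)

lemma ev1_map_poly_single:
  "ev1 \<gamma> d l (map_poly (Poly_Mapping.single \<alpha>) W) = (if \<alpha> = \<gamma> then poly (poly W [:l:]) d else 0)"
  by (induction W) (auto simp: map_poly_pCons ev1_pCons ev0_def lookup_single)

definition CLval where
  "CLval b \<phi> \<gamma> d l f g \<alpha> \<beta> = (if \<alpha> + \<beta> = \<gamma>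
     then poly (Poly_Mapping.lookup f \<alpha>) (- l) * poly (Poly_Mapping.lookup g \<beta>) (l + d)
       * CLc b \<phi> \<alpha> \<beta> d l else 0)"

lemma ev1_CL_bracket:
  assumes "finite A" "Poly_Mapping.keys f \<subseteq> A" "finite B" "Poly_Mapping.keys g \<subseteq> B"
  shows "ev1 \<gamma> d l (CL_bracket b \<phi> f g) = (\<Sum>\<alpha>\<in>A. \<Sum>\<beta>\<in>B. CLval b \<phi> \<gamma> d l f g \<alpha> \<beta>)"
proof -
  have "ev1 \<gamma> d l (CL_bracket b \<phi> f g)
      = (\<Sum>\<alpha>\<in>Poly_Mapping.keys f. \<Sum>\<beta>\<in>Poly_Mapping.keys g. CLval b \<phi> \<gamma> d l f g \<alpha> \<beta>)"
    unfolding CL_bracket_def ev1_sum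
    by (intro sum.cong refl) (simp add: ev1_map_poly_single CLval_def poly_poly_at_minus_lam
        poly_poly_at_lam_plus_partial poly_poly_CL_coeff)
  also have "\<dots> = (\<Sum>\<alpha>\<in>Poly_Mapping.keys f. \<Sum>\<beta>\<in>B. CLval b \<phi> \<gamma> d l f g \<alpha> \<beta>)"
    using assms
    by (intro sum.cong refl sum.mono_neutral_left) (auto simp: CLval_def in_keys_iff)
  also have "\<dots> = (\<Sum>\<alpha>\<in>A. \<Sum>\<beta>\<in>B. CLval b \<phi> \<gamma> d l f g \<alpha> \<beta>)"
    using assms
    by (intro sum.mono_neutral_left) (auto simp: CLval_def in_keys_iff intro!: sum.neutral)
  finally show ?thesis .
qed

lemma CL_bracket_add_left: "CL_bracket b \<phi> (f + f') g = CL_bracket b \<phi> f g + CL_bracket b \<phi> f' g"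
proof (rule ev1_eqI)
  fix \<gamma> d l
  let ?A = "Poly_Mapping.keys f \<union> Poly_Mapping.keys f'" and ?B = "Poly_Mapping.keys g"
  have "CLval b \<phi> \<gamma> d l (f + f') g \<alpha> \<beta> = CLval b \<phi> \<gamma> d l f g \<alpha> \<beta> + CLval b \<phi> \<gamma> d l f' g \<alpha> \<beta>"
    for \<alpha> \<beta>
    by (simp add: CLval_def lookup_add algebra_simps)
  then show "ev1 \<gamma> d l (CL_bracket b \<phi> (f + f') g)
      = ev1 \<gamma> d l (CL_bracket b \<phi> f g + CL_bracket b \<phi> f' g)"
    by (simp add: ev1_add ev1_CL_bracket[of ?A _ ?B] Poly_Mapping.keys_add sum.distrib)
qed

lemma CL_bracket_add_right: "CL_bracket b \<phi> f (g + g') = CL_bracket b \<phi> f g + CL_bracket b \<phi> f g'"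
proof (rule ev1_eqI)
  fix \<gamma> d l
  let ?B = "Poly_Mapping.keys g \<union> Poly_Mapping.keys g'" and ?A = "Poly_Mapping.keys f"
  have "CLval b \<phi> \<gamma> d l f (g + g') \<alpha> \<beta> = CLval b \<phi> \<gamma> d l f g \<alpha> \<beta> + CLval b \<phi> \<gamma> d l f g' \<alpha> \<beta>"
    for \<alpha> \<beta>
    by (simp add: CLval_def lookup_add algebra_simps)
  then show "ev1 \<gamma> d l (CL_bracket b \<phi> f (g + g'))
      = ev1 \<gamma> d l (CL_bracket b \<phi> f g + CL_bracket b \<phi> f g')"
    by (simp add: ev1_add ev1_CL_bracket[of ?A _ ?B] Poly_Mapping.keys_add sum.distrib)
qed

lemma additive_CL_bracket_left: "additive (\<lambda>f. CL_bracket b \<phi> f g)"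
  by unfold_locales (rule CL_bracket_add_left)

lemma additive_CL_bracket_right: "additive (CL_bracket b \<phi> f)"
  by unfold_locales (rule CL_bracket_add_right)

lemma CL_bracket_zero [simp]: "CL_bracket b \<phi> 0 g = 0" "CL_bracket b \<phi> f 0 = 0"
  using additive.zero[OF additive_CL_bracket_left] additive.zero[OF additive_CL_bracket_right]
  by auto

lemma CL_bracket_single:
  "CL_bracket b \<phi> (Poly_Mapping.single \<alpha> p) (Poly_Mapping.single \<beta> q) =
    map_poly (Poly_Mapping.single (\<alpha> + \<beta>))
      (at_minus_lam p * at_lam_plus_partial q * CL_coeff b \<phi> \<alpha> \<beta>)"
  by (cases "p = 0"; cases "q = 0") (simp_all add: CL_bracket_def)

lemma ev1_CL_bracket_single:
  "ev1 \<gamma> d l (CL_bracket b \<phi> (Poly_Mapping.single \<alpha> p) (Poly_Mapping.single \<beta> q)) =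
    (if \<alpha> + \<beta> = \<gamma> then poly p (- l) * poly q (l + d) * CLc b \<phi> \<alpha> \<beta> d l else 0)"
  by (simp add: CL_bracket_single ev1_map_poly_single poly_poly_at_minus_lam
      poly_poly_at_lam_plus_partial poly_poly_CL_coeff)

lemma additive_eq_on_CL_carrier:
  assumes F: "additive F" and G: "additive G"
    and eq: "\<And>\<alpha> p. \<alpha> \<in> \<Delta> \<Longrightarrow> F (Poly_Mapping.single \<alpha> p) = G (Poly_Mapping.single \<alpha> p)"
    and f: "f \<in> CL_carrier \<Delta>"
  shows "F f = G f"
proof -
  have "f = (\<Sum>\<alpha>\<in>Poly_Mapping.keys f. Poly_Mapping.single \<alpha> (Poly_Mapping.lookup f \<alpha>))"
    by (intro poly_mapping_eqI)
       (auto simp: lookup_sum lookup_single when_def in_keys_iff)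
  moreover have "F (\<Sum>\<alpha>\<in>Poly_Mapping.keys f. Poly_Mapping.single \<alpha> (Poly_Mapping.lookup f \<alpha>))
      = G (\<Sum>\<alpha>\<in>Poly_Mapping.keys f. Poly_Mapping.single \<alpha> (Poly_Mapping.lookup f \<alpha>))"
    using f unfolding additive.sum[OF F] additive.sum[OF G]
    by (intro sum.cong refl eq) (auto simp: CL_carrier_def)
  ultimately show ?thesis by simp
qed

lemma module_CL_scale: "module CL_scale"
  by unfold_locales
     (auto intro!: ev0_eqI simp: ev0_CL_scale ev0_add algebra_simps)

lemma CL_scale_ev1: "ev1 \<gamma> d l (CL_bracket b \<phi> (CL_scale p f) g)
    = poly p (- l) * ev1 \<gamma> d l (CL_bracket b \<phi> f g)"
  "ev1 \<gamma> d l (CL_bracket b \<phi> f (CL_scale p g)) = poly p (l + d) * ev1 \<gamma> d l (CL_bracket b \<phi> f g)"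
proof -
  let ?A = "Poly_Mapping.keys f" and ?B = "Poly_Mapping.keys g"
  have *: "Poly_Mapping.keys (CL_scale p h) \<subseteq> Poly_Mapping.keys h" for h
    by (auto simp: in_keys_iff lookup_CL_scale)
  show "ev1 \<gamma> d l (CL_bracket b \<phi> (CL_scale p f) g)
      = poly p (- l) * ev1 \<gamma> d l (CL_bracket b \<phi> f g)"
    using * by (simp add: ev1_CL_bracket[of ?A _ ?B] sum_distrib_left)
      (intro sum.cong refl, simp add: CLval_def lookup_CL_scale)
  show "ev1 \<gamma> d l (CL_bracket b \<phi> f (CL_scale p g))
      = poly p (l + d) * ev1 \<gamma> d l (CL_bracket b \<phi> f g)"
    using * by (simp add: ev1_CL_bracket[of ?A _ ?B] sum_distrib_left)
      (intro sum.cong refl, simp add: CLval_def lookup_CL_scale)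
qed

lemma CLc_jacobi:
  assumes "b \<noteq> 0" "\<phi> (\<alpha> + \<beta>) = \<phi> \<alpha> + \<phi> \<beta>" "\<phi> (\<alpha> + \<delta>) = \<phi> \<alpha> + \<phi> \<delta>" "\<phi> (\<beta> + \<delta>) = \<phi> \<beta> + \<phi> \<delta>"
  shows "CLc b \<phi> \<alpha> (\<beta> + \<delta>) d l * CLc b \<phi> \<beta> \<delta> (l + d) m =
    CLc b \<phi> \<alpha> \<beta> (- (l + m)) l * CLc b \<phi> (\<alpha> + \<beta>) \<delta> d (l + m)
    + CLc b \<phi> \<beta> (\<alpha> + \<delta>) d m * CLc b \<phi> \<alpha> \<delta> (m + d) l"
proof -
  have CLc: "CLc b \<phi> x y d l = b * ((x / b + 1) * d + (x / b + y / b + 2) * l)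
      + (\<phi> x * (y / b) - \<phi> y * (x / b) + \<phi> x - \<phi> y)" for x y d l
    using assms(1) by (simp add: CLc_def field_simps)
  show ?thesis
    unfolding CLc assms(2-) add_divide_distrib by algebra
qed

text \<open>The hypothesis \<open>b \<noteq> 0\<close> follows from \<open>2b \<notin> \<Delta>\<close>, as \<open>0 \<in> \<Delta>\<close>.\<close>
theorem lie_conformal_algebra_CL:
  assumes zero: "0 \<in> \<Delta>" and add: "\<And>\<alpha> \<beta>. \<alpha> \<in> \<Delta> \<Longrightarrow> \<beta> \<in> \<Delta> \<Longrightarrow> \<alpha> + \<beta> \<in> \<Delta>"
    and b: "b \<noteq> 0"
    and hom: "\<And>\<alpha> \<beta>. \<alpha> \<in> \<Delta> \<Longrightarrow> \<beta> \<in> \<Delta> \<Longrightarrow> \<phi> (\<alpha> + \<beta>) = \<phi> \<alpha> + \<phi> \<beta>"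
  shows "lie_conformal_algebra CL_scale (CL_carrier \<Delta>) (CL_bracket b \<phi>)"
proof -
  interpret module CL_scale by (rule module_CL_scale)
  let ?br = "CL_bracket b \<phi>" and ?s = "Poly_Mapping.single :: complex \<Rightarrow> complex poly \<Rightarrow> cl"
  have sub: "subspace (CL_carrier \<Delta>)"
    unfolding subspace_def CL_carrier_def
    by (auto simp: in_keys_iff lookup_CL_scale dest!: subsetD[OF Poly_Mapping.keys_add])
  have closed: "coeff (?br f g) n \<in> CL_carrier \<Delta>"
    if "f \<in> CL_carrier \<Delta>" "g \<in> CL_carrier \<Delta>" for f g n
    unfolding CL_bracket_def coeff_sum using that add
    by (intro subspace_sum[OF sub]) (auto simp: coeff_map_poly CL_carrier_def split: if_splits)
  have skew: "?br f g = - subst_skew (CL_scale [:0, 1:]) (?br g f)"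
    if f: "f \<in> CL_carrier \<Delta>" and g: "g \<in> CL_carrier \<Delta>" for f g
  proof (rule ev1_eqI)
    fix \<gamma> d l
    have sym: "CLc b \<phi> \<alpha> \<beta> d l = - CLc b \<phi> \<beta> \<alpha> d (- l - d)" for \<alpha> \<beta>
      using b by (simp add: CLc_def field_simps)
    have l: "additive (\<lambda>f. ev1 \<gamma> d x (?br f g))" for x g
      by unfold_locales (simp add: CL_bracket_add_left ev1_add)
    have r: "additive (\<lambda>g. - ev1 \<gamma> d x (?br g f))" for x f
      by unfold_locales (simp add: CL_bracket_add_left ev1_add)
    have l': "additive (\<lambda>g. ev1 \<gamma> d x (?br f g))" for x f
      by unfold_locales (simp add: CL_bracket_add_right ev1_add)
    have r': "additive (\<lambda>f. - ev1 \<gamma> d x (?br g f))" for x g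
      by unfold_locales (simp add: CL_bracket_add_right ev1_add)
    have "ev1 \<gamma> d l (?br f g) = - ev1 \<gamma> d (- l - d) (?br g f)"
    proof (rule additive_eq_on_CL_carrier[OF l r' _ f])
      fix \<alpha> p
      show "ev1 \<gamma> d l (?br (?s \<alpha> p) g) = - ev1 \<gamma> d (- l - d) (?br g (?s \<alpha> p))"
      proof (rule additive_eq_on_CL_carrier[OF l' r _ g])
        fix \<beta> q
        show "ev1 \<gamma> d l (?br (?s \<alpha> p) (?s \<beta> q)) = - ev1 \<gamma> d (- l - d) (?br (?s \<beta> q) (?s \<alpha> p))"
          using sym[of \<alpha> \<beta>] by (simp add: ev1_CL_bracket_single add.commute mult_ac)
      qed
    qed
    then show "ev1 \<gamma> d l (?br f g) = ev1 \<gamma> d l (- subst_skew (CL_scale [:0, 1:]) (?br g f))"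
      by (simp add: ev1_minus ev1_subst_skew)
  qed
  have jacobi: "lam_mu ?br f g h = lam_plus_mu ?br (?br f g) h + mu_lam ?br g f h"
    if f: "f \<in> CL_carrier \<Delta>" and g: "g \<in> CL_carrier \<Delta>" and h: "h \<in> CL_carrier \<Delta>" for f g h
  proof (rule ev2_eqI)
    fix \<gamma> d l m
    define J1 where "J1 f g h = poly (map_poly (\<lambda>c. ev1 \<gamma> d l (?br f c)) (?br g h)) m" for f g h
    define J2 where "J2 f g h = poly (map_poly (\<lambda>c. ev1 \<gamma> d (l + m) (?br c h)) (?br f g)) l
      + poly (map_poly (\<lambda>c. ev1 \<gamma> d m (?br g c)) (?br f h)) l" for f g h
    have L: "additive (\<lambda>f. ev1 \<gamma> d x (?br f g))" and R: "additive (\<lambda>g. ev1 \<gamma> d x (?br f g))"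
      for x f g
      by (unfold_locales; simp add: CL_bracket_add_left CL_bracket_add_right ev1_add)+
    note [simp] = CL_bracket_add_left CL_bracket_add_right ev1_add poly_map_poly_fun_add
      additive.add[OF poly_map_poly_additive[OF L]] additive.add[OF poly_map_poly_additive[OF R]]
    have J1: "additive (\<lambda>f. J1 f g h)" "additive (\<lambda>g. J1 f g h)" "additive (\<lambda>h. J1 f g h)" for f g h
      by (unfold_locales; simp add: J1_def)+
    have J2: "additive (\<lambda>f. J2 f g h)" "additive (\<lambda>g. J2 f g h)" "additive (\<lambda>h. J2 f g h)" for f g h
      by (unfold_locales; simp add: J2_def)+
    have R1: "poly (map_poly (\<lambda>c. ev1 \<gamma> d x (?br (?s \<alpha> p) c)) (?br (?s \<beta> q) (?s \<delta> r))) y =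
      (if \<alpha> + \<beta> + \<delta> = \<gamma> then poly p (- x) * CLc b \<phi> \<alpha> (\<beta> + \<delta>) d x
         * (poly q (- y) * poly r (y + (x + d)) * CLc b \<phi> \<beta> \<delta> (x + d) y) else 0)"
      for x y \<alpha> \<beta> \<delta> p q r
    proof -
      have "poly (map_poly (\<lambda>w. if \<alpha> + \<beta> + \<delta> = \<gamma> then
              poly p (- x) * poly w (x + d) * CLc b \<phi> \<alpha> (\<beta> + \<delta>) d x else 0) W) y =
          (if \<alpha> + \<beta> + \<delta> = \<gamma> then
              poly p (- x) * CLc b \<phi> \<alpha> (\<beta> + \<delta>) d x * poly (poly W [:y:]) (x + d) else 0)" for W
        by (induction W) (auto simp: map_poly_pCons algebra_simps)
      then show ?thesis
        by (simp add: CL_bracket_single[of _ _ \<beta>] map_poly_map_poly o_def ev1_CL_bracket_single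
          poly_poly_at_minus_lam poly_poly_at_lam_plus_partial poly_poly_CL_coeff
          flip: add.assoc)
    qed
    have R2: "poly (map_poly (\<lambda>c. ev1 \<gamma> d x (?br c (?s \<delta> r))) (?br (?s \<alpha> p) (?s \<beta> q))) y =
      (if \<alpha> + \<beta> + \<delta> = \<gamma> then poly r (x + d) * CLc b \<phi> (\<alpha> + \<beta>) \<delta> d x
         * (poly p (- y) * poly q (y - x) * CLc b \<phi> \<alpha> \<beta> (- x) y) else 0)"
      for x y \<alpha> \<beta> \<delta> p q r
    proof -
      have "poly (map_poly (\<lambda>w. if \<alpha> + \<beta> + \<delta> = \<gamma> then
              poly w (- x) * poly r (x + d) * CLc b \<phi> (\<alpha> + \<beta>) \<delta> d x else 0) W) y =
          (if \<alpha> + \<beta> + \<delta> = \<gamma> then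
              poly r (x + d) * CLc b \<phi> (\<alpha> + \<beta>) \<delta> d x * poly (poly W [:y:]) (- x) else 0)" for W
        by (induction W) (auto simp: map_poly_pCons algebra_simps)
      then show ?thesis
        by (simp add: CL_bracket_single[of _ _ \<alpha>] map_poly_map_poly o_def ev1_CL_bracket_single
          poly_poly_at_minus_lam poly_poly_at_lam_plus_partial poly_poly_CL_coeff)
    qed
    have single: "J1 (?s \<alpha> p) (?s \<beta> q) (?s \<delta> r) = J2 (?s \<alpha> p) (?s \<beta> q) (?s \<delta> r)"
      if "\<alpha> \<in> \<Delta>" "\<beta> \<in> \<Delta>" "\<delta> \<in> \<Delta>" for \<alpha> \<beta> \<delta> p q r
    proof (cases "\<alpha> + \<beta> + \<delta> = \<gamma>")
      case True
      have "J1 (?s \<alpha> p) (?s \<beta> q) (?s \<delta> r) = poly p (- l) * poly q (- m) * poly r (l + m + d)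
          * (CLc b \<phi> \<alpha> (\<beta> + \<delta>) d l * CLc b \<phi> \<beta> \<delta> (l + d) m)"
        using True by (simp add: J1_def R1 ac_simps)
      moreover have "J2 (?s \<alpha> p) (?s \<beta> q) (?s \<delta> r) = poly p (- l) * poly q (- m) * poly r (l + m + d)
          * (CLc b \<phi> \<alpha> \<beta> (- (l + m)) l * CLc b \<phi> (\<alpha> + \<beta>) \<delta> d (l + m)
            + CLc b \<phi> \<beta> (\<alpha> + \<delta>) d m * CLc b \<phi> \<alpha> \<delta> (m + d) l)"
        using True by (simp add: J2_def R1 R2 ac_simps distrib_left)
      ultimately show ?thesis
        using CLc_jacobi[where b = b and \<phi> = \<phi> and \<alpha> = \<alpha> and \<beta> = \<beta> and \<delta> = \<delta>] b that
        by (simp add: hom)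
    next
      case False
      then have "\<beta> + \<alpha> + \<delta> \<noteq> \<gamma>" by (simp add: add.commute)
      with False show ?thesis by (simp add: J1_def J2_def R1 R2)
    qed
    have "J1 f g h = J2 f g h"
    proof (rule additive_eq_on_CL_carrier[OF J1(1) J2(1) _ f])
      fix \<alpha> p assume \<alpha>: "\<alpha> \<in> \<Delta>"
      show "J1 (?s \<alpha> p) g h = J2 (?s \<alpha> p) g h"
      proof (rule additive_eq_on_CL_carrier[OF J1(2) J2(2) _ g])
        fix \<beta> q assume \<beta>: "\<beta> \<in> \<Delta>"
        show "J1 (?s \<alpha> p) (?s \<beta> q) h = J2 (?s \<alpha> p) (?s \<beta> q) h"
          by (rule additive_eq_on_CL_carrier[OF J1(3) J2(3) _ h]) (rule single[OF \<alpha> \<beta>])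
      qed
    qed
    then show "ev2 \<gamma> d l m (lam_mu ?br f g h)
        = ev2 \<gamma> d l m (lam_plus_mu ?br (?br f g) h + mu_lam ?br g f h)"
      by (simp add: ev2_add ev2_lam_mu ev2_mu_lam ev2_lam_plus_mu J1_def J2_def)
  qed
  show ?thesis
  proof unfold_locales
    fix f g :: cl and k
    show "?br (CL_scale [:k:] f) g = map_poly (CL_scale [:k:]) (?br f g)"
      and "?br f (CL_scale [:k:] g) = map_poly (CL_scale [:k:]) (?br f g)"
      by (rule ev1_eqI, simp add: CL_scale_ev1 ev1_map_poly_CL_scale)+
    show "?br (CL_scale [:0, 1:] f) g = - pCons 0 (?br f g)"
      by (rule ev1_eqI) (simp add: CL_scale_ev1 ev1_minus ev1_pCons)
    show "?br f (CL_scale [:0, 1:] g) = pCons 0 (?br f g) + map_poly (CL_scale [:0, 1:]) (?br f g)"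
      by (rule ev1_eqI)
         (simp add: CL_scale_ev1 ev1_add ev1_pCons ev1_map_poly_CL_scale algebra_simps)
  qed (rule sub closed skew jacobi CL_bracket_add_left CL_bracket_add_right; assumption)+
qed

end

theory Submission
  imports Defs "HOL-Computational_Algebra.Polynomial_Factorial"
    "HOL-Computational_Algebra.Field_as_Ring"
    "HOL-Computational_Algebra.Fundamental_Theorem_Algebra"
begin

text \<open>
  Write \<open>x\<^bsub>\<alpha>,n\<^esub>\<close> for the coefficient of \<open>\<lambda>\<^sup>n\<close> in the action of \<open>x\<^sub>\<alpha>\<close>, and let
  \<open>E = x\<^bsub>0,0\<^esub>\<close>, \<open>H = x\<^bsub>0,1\<^esub>\<close> and \<open>T = E - b \<partial>\<close>. The module axioms give
  \<open>[H, E] = b E\<close>, \<open>[H, \<partial>] = E\<close>, make \<open>T\<close> commute with \<open>E\<close>, \<open>H\<close> and \<open>\<partial>\<close>, and show that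
  \<open>x\<^bsub>\<beta>,n\<^esub>\<close> shifts eigenvalues of \<open>T\<close> by \<open>-\<phi>(\<beta>)\<close> and, if \<open>\<phi>(\<beta>) = 0\<close>, eigenvalues
  of \<open>H\<close> by \<open>\<beta> + b - n b\<close>. On a finitely generated module these spectra are too small to admit
  such shifts for all \<open>\<beta> \<in> \<Delta>\<close>.

  The kernel of \<open>E\<close> is the part on which the whole algebra acts as zero, and modulo this kernel the
  module is torsion-free over \<open>\<complex>[E]\<close> (\<open>mode_zero_if_E_poly\<close>). A Cayley-Hamilton relation for
  \<open>T\<close> over \<open>\<complex>[\<partial>]\<close> may be differentiated in \<open>\<partial>\<close> by taking commutators with \<open>H\<close>; so
  modulo the kernel of \<open>E\<close> the operator \<open>T\<close> satisfies a polynomial with constant coefficients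
  (\<open>ex_poly_T\<close>). Consequently \<open>range E\<close> is finitely generated over \<open>\<complex>[E]\<close>, and \<open>H\<close>
  satisfies a polynomial \<open>h\<close> on the finite-dimensional space \<open>range E / range (E\<^sup>2)\<close>
  (\<open>ex_poly_H\<close>). In effect, the weights of \<open>H\<close> on \<open>range E\<close> lie in finitely many progressions
  \<open>f + b \<nat>\<close>.

  Let \<open>\<beta> \<in> \<Delta>\<close>. If \<open>\<phi>(\<beta>) \<noteq> 0\<close>, then some multiple of \<open>\<beta>\<close> shifts every eigenvalue
  of \<open>T\<close> to a number that is not one (\<open>E_mode_zero_if_phi_nonzero\<close>). If \<open>\<phi> = 0\<close> and
  \<open>\<beta> \<noteq> 0\<close>, then some multiple \<open>\<gamma>\<close> of \<open>\<beta>\<close> is such that \<open>\<gamma> / b\<close> has very negative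
  real part or very large imaginary part, and \<open>x\<^bsub>\<gamma>,n\<^esub>\<close> moves the lowest weights to numbers
  outside these progressions. This is made precise \<open>E\<close>-adically: the images lie in all
  \<open>range (E\<^sup>l)\<close>, whose intersection is zero (\<open>E_mode_E_in_E_powers\<close>, \<open>E_adic_separated\<close>).
  In both cases some \<open>x\<^sub>\<gamma>\<close> acts as zero modulo the kernel of \<open>E\<close>. As \<open>b \<notin> \<Delta>\<close>, the bracket
  of \<open>x\<^bsub>-\<gamma>\<^esub>\<close> and \<open>x\<^sub>\<gamma>\<close> is a nonzero multiple of \<open>x\<^sub>0\<close> over \<open>\<complex>[\<partial>,\<lambda>]\<close>, so \<open>x\<^sub>0\<close>
  acts as zero modulo the kernel of \<open>E\<close> too. Then \<open>E\<^sup>2 = 0\<close>, whence \<open>E = 0\<close>, and the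
  action is trivial (\<open>mode_zero_if_E_mode_zero\<close>).
\<close>

section \<open>Finitely generated modules over Euclidean rings\<close>

text \<open>
  A Euclidean ring is Noetherian. The statement is relative to \<open>K\<close>, that is, about submodules of
  \<open>span (B \<union> K) / K\<close>, so that no quotient module has to be formed. The induction removes one
  generator \<open>g\<close> at a time: the coefficients of \<open>g\<close> in elements of \<open>U\<close> form an ideal, which is
  generated by any of its nonzero elements of least Euclidean size.
\<close>
lemma fin_gen_submodule_relative:
  fixes scale :: "'r::euclidean_ring \<Rightarrow> 'v::ab_group_add \<Rightarrow> 'v"
  assumes "module scale" and "finite B" and "module.subspace scale U" and "K \<subseteq> U"
    and "U \<subseteq> module.span scale (B \<union> K)"
  shows "\<exists>F. finite F \<and> F \<subseteq> U \<and> U \<subseteq> module.span scale (F \<union> K)"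
proof -
  interpret module scale by fact
  show ?thesis
    using assms(2-5)
  proof (induction B arbitrary: U)
    case empty
    then show ?case by (intro exI[of _ "{}"]) auto
  next
    case (insert g B)
    let ?S = "span (B \<union> K)"
    note U = \<open>subspace U\<close>
    have "subspace (U \<inter> ?S)" "K \<subseteq> U \<inter> ?S"
      using insert.prems by (auto intro: subspace_inter span_base)
    from insert.IH[OF this] obtain F where F: "finite F" "F \<subseteq> U" "U \<inter> ?S \<subseteq> span (F \<union> K)"
      by auto
    define I where "I = {p. \<exists>s\<in>?S. scale p g + s \<in> U}"
    have split: "\<exists>k\<in>I. u - scale k g \<in> ?S" if "u \<in> U" for u
    proof -
      from that insert.prems have "u \<in> span (insert g (B \<union> K))" by auto
      then obtain k where "u - scale k g \<in> ?S" by (auto simp: span_insert)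
      moreover from this that have "k \<in> I"
        unfolding I_def by (intro CollectI bexI[of _ "u - scale k g"]) simp_all
      ultimately show ?thesis by blast
    qed
    show ?case
    proof (cases "I \<subseteq> {0}")
      case True
      with split have "U \<subseteq> ?S" by fastforce
      with F show ?thesis by (intro exI[of _ F]) auto
    next
      case False
      define m where "m = arg_min euclidean_size (\<lambda>p. p \<in> I \<and> p \<noteq> 0)"
      from False have ex: "\<exists>p. p \<in> I \<and> p \<noteq> 0" by auto
      have m: "m \<in> I" "m \<noteq> 0"
        using arg_min_natI[of "\<lambda>p. p \<in> I \<and> p \<noteq> 0" _ euclidean_size] ex unfolding m_def by auto
      have min: "p = 0" if "p \<in> I" "euclidean_size p < euclidean_size m" for p
        using arg_min_nat_le[of "\<lambda>p. p \<in> I \<and> p \<noteq> 0" p euclidean_size] that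
        unfolding m_def by force
      from m obtain s0 where s0: "s0 \<in> ?S" "scale m g + s0 \<in> U" by (auto simp: I_def)
      let ?u0 = "scale m g + s0"
      have "u \<in> span (insert ?u0 F \<union> K)" if u: "u \<in> U" for u
      proof -
        from split[OF u] obtain k where k: "u - scale k g \<in> ?S" by blast
        let ?d = "k div m"
        let ?r = "u - scale ?d ?u0"
        have r: "?r \<in> U" using U u s0 by (intro subspace_diff subspace_scale)
        have eq: "?r = scale (k mod m) g + ((u - scale k g) - scale ?d s0)"
        proof -
          have "scale k g = scale (?d * m + k mod m) g" by simp
          then show ?thesis by (simp only: scale_left_distrib) (simp add: algebra_simps)
        qed
        have s: "(u - scale k g) - scale ?d s0 \<in> ?S"
          by (rule span_diff[OF k span_scale[OF s0(1)]])
        have "k mod m \<in> I" using r s unfolding eq I_def by blast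
        then have "k mod m = 0" using min mod_size_less[OF m(2)] by blast
        then have "?r \<in> ?S" unfolding eq using s by (simp only: scale_zero_left add_0)
        with r F have "?r \<in> span (F \<union> K)" by auto
        then have "?r \<in> span (insert ?u0 F \<union> K)" by (rule subsetD[OF span_mono, rotated]) auto
        moreover have "scale ?d ?u0 \<in> span (insert ?u0 F \<union> K)"
          by (intro span_scale span_base) auto
        ultimately show ?thesis using span_add[of ?r _ "scale ?d ?u0"] by simp
      qed
      with F s0 show ?thesis by (intro exI[of _ "insert ?u0 F"]) auto
    qed
  qed
qed

text \<open>
  The ascending chain condition for the submodules generated by initial segments of a sequence. For
  \<open>u i = A\<^sup>i g\<close> it shows that \<open>A\<close> is integral, and for \<open>u i = A u (i + 1)\<close> it yields
  Krull's intersection theorem.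
\<close>
lemma sequence_in_fin_gen_module:
  fixes scale :: "'r::euclidean_ring \<Rightarrow> 'v::ab_group_add \<Rightarrow> 'v"
  assumes "module scale" and "finite B" and u: "\<And>i. u i \<in> module.span scale (B \<union> K)"
  shows "\<exists>k::nat. u k \<in> module.span scale (u ` {..<k} \<union> K)"
proof -
  interpret module scale by fact
  let ?U = "span (range u \<union> K)" and ?S = "\<lambda>k. span (u ` {..<k} \<union> K)"
  have mono: "?S i \<subseteq> ?S j" if "i \<le> j" for i j
    using that by (intro span_mono) auto
  have "?U \<subseteq> span (B \<union> K)"
    using u by (intro span_minimal) (auto intro: span_base)
  moreover have "K \<subseteq> ?U" by (auto intro: span_base)
  ultimately obtain F where F: "finite F" "F \<subseteq> ?U" "?U \<subseteq> span (F \<union> K)"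
    using fin_gen_submodule_relative[OF assms(1,2) subspace_span, of K "range u \<union> K"] by auto
  have "subspace (\<Union>k. ?S k)"
  proof (rule subspaceI)
    show "0 \<in> (\<Union>k. ?S k)" by (auto intro: span_zero)
  next
    fix x y assume "x \<in> (\<Union>k. ?S k)" "y \<in> (\<Union>k. ?S k)"
    then obtain i j where "x \<in> ?S i" "y \<in> ?S j" by auto
    then have "x \<in> ?S (max i j)" "y \<in> ?S (max i j)"
      using mono[of i "max i j"] mono[of j "max i j"] by auto
    then show "x + y \<in> (\<Union>k. ?S k)" by (auto intro: span_add)
  next
    fix c x assume "x \<in> (\<Union>k. ?S k)"
    then show "scale c x \<in> (\<Union>k. ?S k)" by (auto intro: span_scale)
  qed
  moreover have "range u \<union> K \<subseteq> (\<Union>k. ?S k)"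
    by (auto intro!: span_base)
  ultimately have U: "?U \<subseteq> (\<Union>k. ?S k)" by (intro span_minimal)
  have "\<exists>k. F \<subseteq> ?S k"
    using F(1) subset_trans[OF F(2) U]
  proof (induction F)
    case (insert f F)
    then obtain i j where "F \<subseteq> ?S i" "f \<in> ?S j" by auto
    then have "insert f F \<subseteq> ?S (max i j)"
      using mono[of i "max i j"] mono[of j "max i j"] by auto
    then show ?case by blast
  qed auto
  then obtain k where "F \<subseteq> ?S k" by blast
  then have "F \<union> K \<subseteq> ?S k" by (auto intro: span_base)
  then have "span (F \<union> K) \<subseteq> ?S k" by (intro span_minimal) auto
  moreover have "u k \<in> ?U" by (auto intro: span_base)
  ultimately show ?thesis using F(3) by blast
qed

section \<open>Polynomials in an endomorphism of a module\<close>

text \<open>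
  The value of \<open>p(A)\<close> at \<open>v\<close>. The scalar action is a parameter because complex scalars and
  scalars in \<open>\<complex>[\<partial>]\<close> both occur on the same group.
\<close>
definition op_poly :: "('r::comm_ring_1 \<Rightarrow> 'v \<Rightarrow> 'v) \<Rightarrow> ('v \<Rightarrow> 'v) \<Rightarrow> 'r poly \<Rightarrow> 'v::ab_group_add \<Rightarrow> 'v"
  where "op_poly scale A p v = (\<Sum>i\<le>degree p. scale (coeff p i) ((A ^^ i) v))"

locale module_endo = module scale for scale :: "'r::comm_ring_1 \<Rightarrow> 'v::ab_group_add \<Rightarrow> 'v" +
  fixes A :: "'v \<Rightarrow> 'v"
  assumes A_add: "A (v + w) = A v + A w" and A_scale: "A (scale c v) = scale c (A v)"
begin

abbreviation app :: "'r poly \<Rightarrow> 'v \<Rightarrow> 'v" where "app \<equiv> op_poly scale A"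

lemma A_additive: "additive A"
  by unfold_locales (rule A_add)

lemmas A_zero [simp] = additive.zero[OF A_additive] and A_sum = additive.sum[OF A_additive]

lemma power_add: "(A ^^ n) (v + w) = (A ^^ n) v + (A ^^ n) w"
  by (induction n) (simp_all add: A_add)

lemma power_scale: "(A ^^ n) (scale c v) = scale c ((A ^^ n) v)"
  by (induction n) (simp_all add: A_scale)

lemma app_bound:
  assumes "degree p \<le> N"
  shows "app p v = (\<Sum>i\<le>N. scale (coeff p i) ((A ^^ i) v))"
  unfolding op_poly_def using assms
  by (intro sum.mono_neutral_left) (auto simp: coeff_eq_0)

lemma app_0 [simp]: "app 0 v = 0"
  by (simp add: op_poly_def)

lemma app_pCons: "app (pCons a p) v = scale a v + A (app p v)"
proof -
  have "app (pCons a p) v = (\<Sum>i\<le>Suc (degree p). scale (coeff (pCons a p) i) ((A ^^ i) v))"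
    by (rule app_bound) (simp add: degree_pCons_le)
  then show ?thesis
    by (simp add: sum.atMost_Suc_shift A_sum A_scale op_poly_def del: sum.atMost_Suc)
qed

lemma app_const: "app [:a:] v = scale a v"
  by (simp add: app_pCons)

lemma app_add_left: "app (p + q) v = app p v + app q v"
proof -
  let ?N = "max (degree p) (degree q)"
  have "app r v = (\<Sum>i\<le>?N. scale (coeff r i) ((A ^^ i) v))" if "r \<in> {p, q, p + q}" for r
    using that by (intro app_bound) (auto simp: degree_add_le)
  then show ?thesis by (simp add: scale_left_distrib sum.distrib)
qed

lemma app_add_right: "app p (v + w) = app p v + app p w"
  by (simp add: op_poly_def power_add scale_right_distrib sum.distrib)

lemma app_scale: "app p (scale c v) = scale c (app p v)"
  by (simp add: op_poly_def power_scale scale_sum_right mult.commute)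

lemma app_smult: "app (smult a p) v = scale a (app p v)"
  by (induction p) (simp_all add: app_pCons scale_right_distrib A_scale)

lemma app_mult: "app (p * q) v = app p (app q v)"
  by (induction p) (simp_all add: app_pCons app_add_left app_smult)

sublocale poly: module app
  by unfold_locales (simp_all add: app_add_left app_add_right app_const one_pCons flip: app_mult)

lemma app_diff: "app (p - q) v = app p v - app q v"
  by (rule poly.scale_left_diff_distrib)

lemma app_mem:
  assumes "subspace S" "\<And>w. w \<in> S \<Longrightarrow> A w \<in> S" "v \<in> S"
  shows "app p v \<in> S"
  by (induction p) (auto simp: app_pCons assms intro!: subspace_add subspace_scale subspace_0)

text \<open>
  This replaces decompositions into eigenspaces: that an element belongs to two disjoint sets of
  eigenvalues of \<open>A\<close> modulo \<open>S\<close> is expressed by two coprime polynomials.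
\<close>
lemma app_mem_coprime:
  assumes S: "subspace S" "\<And>w. w \<in> S \<Longrightarrow> A w \<in> S"
    and "app p v \<in> S" "app q v \<in> S" "s * p + t * q = 1"
  shows "v \<in> S"
proof -
  have "v = app (s * p + t * q) v" by (simp add: assms)
  also have "\<dots> = app s (app p v) + app t (app q v)" by (simp only: app_add_left app_mult)
  finally show ?thesis using assms by (metis app_mem subspace_add)
qed

text \<open>
  An operator that raises eigenvalues of \<open>A\<close> by \<open>c\<close>, expressed by polynomials.
\<close>
lemma app_shift:
  assumes X: "additive X" "\<And>c v. X (scale c v) = scale c (X v)"
    and c: "\<And>v. A (X v) = X (A v) + scale c (X v)"
  shows "app p (X v) = X (app (pcompose p [:c, 1:]) v)"
proof (induction p)
  case 0
  then show ?case by (simp add: additive.zero[OF X(1)])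
next
  case (pCons a p)
  then show ?case
    by (simp add: app_pCons pcompose_pCons app_add_left app_const app_mult app_smult c
        additive.add[OF X(1)] X(2) ac_simps)
qed

lemma pcompose_shift_cancel: "pcompose (pcompose p [:- c, 1:]) [:c, 1:] = (p :: 'r poly)"
  by (simp add: pcompose_assoc[symmetric] pcompose_pCons)

end

text \<open>
  Cayley-Hamilton on \<open>span (B \<union> K) / K\<close>, without determinants: the powers of \<open>A\<close> at one
  generator satisfy a monic relation by the ascending chain condition, and the product of these
  relations over the generators annihilates everything.
\<close>
lemma poly_annihilating_endo_relative:
  fixes scale :: "'r::euclidean_ring \<Rightarrow> 'v::ab_group_add \<Rightarrow> 'v"
  assumes "module_endo scale A" and B: "finite B"
    and K: "module.subspace scale K" "\<And>v. v \<in> K \<Longrightarrow> A v \<in> K"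
    and M: "\<And>v. v \<in> module.span scale (B \<union> K) \<Longrightarrow> A v \<in> module.span scale (B \<union> K)"
  shows "\<exists>p. p \<noteq> 0 \<and> (\<forall>v \<in> module.span scale (B \<union> K). op_poly scale A p v \<in> K)"
proof -
  interpret module_endo scale A by fact
  have "\<exists>p. p \<noteq> 0 \<and> app p g \<in> K" if g: "g \<in> B" for g
  proof -
    let ?u = "\<lambda>i. (A ^^ i) g"
    have u: "?u i \<in> span (B \<union> K)" for i
      by (induction i) (auto simp: g M intro: span_base)
    obtain k where k: "?u k \<in> span (?u ` {..<k} \<union> K)"
      using sequence_in_fin_gen_module[where u = ?u, OF module_axioms B u] by blast
    let ?S = "{w. \<exists>r. (\<forall>i\<ge>k. coeff r i = 0) \<and> w - app r g \<in> K}"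
    have "subspace ?S"
    proof (rule subspaceI; clarify?)
      show "\<exists>r. (\<forall>i\<ge>k. coeff r i = 0) \<and> 0 - app r g \<in> K"
        by (intro exI[of _ 0]) (simp add: subspace_0[OF K(1)])
    next
      fix x y r s assume *: "\<forall>i\<ge>k. coeff r i = 0" "x - app r g \<in> K"
        "\<forall>i\<ge>k. coeff s i = 0" "y - app s g \<in> K"
      have "x + y - app (r + s) g = (x - app r g) + (y - app s g)"
        by (simp add: app_add_left)
      then have "x + y - app (r + s) g \<in> K" using * subspace_add[OF K(1)] by metis
      with * show "\<exists>r. (\<forall>i\<ge>k. coeff r i = 0) \<and> x + y - app r g \<in> K"
        by (intro exI[of _ "r + s"]) simp
    next
      fix c x r assume *: "\<forall>i\<ge>k. coeff r i = 0" "x - app r g \<in> K"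
      have "scale c x - app (smult c r) g = scale c (x - app r g)"
        by (simp add: app_smult scale_right_diff_distrib)
      then have "scale c x - app (smult c r) g \<in> K" using * subspace_scale[OF K(1)] by metis
      with * show "\<exists>r. (\<forall>i\<ge>k. coeff r i = 0) \<and> scale c x - app r g \<in> K"
        by (intro exI[of _ "smult c r"]) simp
    qed
    moreover have "app (monom 1 i) g = (A ^^ i) g" for i
      by (induction i) (simp_all add: monom_Suc app_pCons app_const monom_0 flip: one_pCons)
    note mon = this
    have "?u ` {..<k} \<union> K \<subseteq> ?S"
    proof -
      have "(A ^^ i) g \<in> ?S" if "i < k" for i
        using that by (auto intro!: exI[of _ "monom 1 i"] simp: mon subspace_0[OF K(1)])
      moreover have "w \<in> ?S" if "w \<in> K" for w
        using that by (auto intro!: exI[of _ 0])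
      ultimately show ?thesis by blast
    qed
    ultimately have "span (?u ` {..<k} \<union> K) \<subseteq> ?S" by (intro span_minimal)
    with k obtain r where r: "\<forall>i\<ge>k. coeff r i = 0" "?u k - app r g \<in> K" by blast
    have "coeff (monom 1 k - r) k = 1" using r by simp
    then have "monom 1 k - r \<noteq> 0" by (metis coeff_0 zero_neq_one)
    with r show ?thesis by (intro exI[of _ "monom 1 k - r"]) (simp add: app_diff mon)
  qed
  then obtain f where f: "\<And>g. g \<in> B \<Longrightarrow> f g \<noteq> 0 \<and> app (f g) g \<in> K" by metis
  let ?p = "prod f B"
  have "subspace {v. app ?p v \<in> K}"
    by (rule subspaceI) (auto simp: app_add_right app_scale intro: subspace_add[OF K(1)]
        subspace_scale[OF K(1)] subspace_0[OF K(1)])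
  moreover have "app ?p g \<in> K" if "g \<in> B" for g
  proof -
    have "?p = prod f (B - {g}) * f g"
      using prod.remove[OF B that, of f] by (simp only: mult.commute)
    then have "app ?p g = app (prod f (B - {g})) (app (f g) g)" by (simp only: app_mult)
    then show ?thesis using f[OF that] app_mem[OF K] by metis
  qed
  then have "B \<union> K \<subseteq> {v. app ?p v \<in> K}" using app_mem[OF K] by blast
  ultimately have "span (B \<union> K) \<subseteq> {v. app ?p v \<in> K}" by (intro span_minimal)
  moreover have "?p \<noteq> 0" using f B by (simp add: prod_zero_iff)
  ultimately show ?thesis by blast
qed

section \<open>Coprime polynomials, multiples of a complex number, and descent\<close>

lemma bezout_complex_poly:
  fixes p q :: "complex poly"
  assumes "p \<noteq> 0" and "\<And>z. poly p z = 0 \<Longrightarrow> poly q z \<noteq> 0"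
  shows "\<exists>s t. s * p + t * q = 1"
proof -
  have "degree (gcd p q) = 0"
  proof (rule ccontr)
    assume "degree (gcd p q) \<noteq> 0"
    then obtain z where "poly (gcd p q) z = 0"
      using fundamental_theorem_of_algebra by (metis constant_degree)
    then have "poly p z = 0" "poly q z = 0"
      by (meson dvd_trans gcd_dvd1 gcd_dvd2 poly_eq_0_iff_dvd)+
    with assms show False by blast
  qed
  then have "coprime p q"
    using assms(1) by (metis coprime_iff_gcd_eq_1 gcd_eq_0_iff is_unit_gcd_iff is_unit_iff_degree)
  then show ?thesis by (metis bezout_coefficients_fst_snd coprime_imp_gcd_eq_1)
qed

lemma ex_nat_multiple_notin:
  fixes S :: "complex set"
  assumes "finite S" "c \<noteq> 0"
  shows "\<exists>k::nat. of_nat k * c \<notin> S"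
proof -
  have "inj (\<lambda>k::nat. of_nat k * c)" using assms(2) by (intro injI) simp
  then have "infinite (range (\<lambda>k::nat. of_nat k * c))" by (rule range_inj_infinite)
  then show ?thesis using assms(1) by (metis finite_subset image_subsetI)
qed

text \<open>
  The points \<open>d + N\<close> have bounded imaginary part and real part bounded below, whereas the integer
  multiples of \<open>g\<close> leave any such region: horizontally to the left if \<open>Re g \<noteq> 0\<close>, and
  vertically otherwise.
\<close>
lemma ex_multiple_avoiding_cones:
  fixes g :: complex
  assumes "finite S" "g \<noteq> 0"
  shows "\<exists>k::nat. \<exists>s\<in>{1, -1}. \<forall>d\<in>S. \<forall>N::nat. of_nat k * (s * g) \<noteq> d + of_nat N"
proof -
  \<comment> \<open>Any bound for the norms on \<open>S\<close>; a sum also covers the empty set.\<close>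
  define R where "R = (\<Sum>d\<in>S. norm d)"
  have R: "norm d \<le> R" if "d \<in> S" for d
    using that assms(1) unfolding R_def by (intro member_le_sum) auto
  show ?thesis
  proof (cases "Re g = 0")
    case True
    with assms(2) have "\<bar>Im g\<bar> > 0" by (simp add: complex_eq_iff)
    then obtain k :: nat where k: "R < of_nat k * \<bar>Im g\<bar>" using reals_Archimedean3 by blast
    have "of_nat k * (1 * g) \<noteq> d + of_nat N" if "d \<in> S" for d and N :: nat
    proof
      assume "of_nat k * (1 * g) = d + of_nat N"
      then have "Im d = of_nat k * Im g" by (simp add: complex_eq_iff)
      then have "\<bar>Im d\<bar> = of_nat k * \<bar>Im g\<bar>" by (simp add: abs_mult)
      with k R[OF that] abs_Im_le_cmod[of d] show False by linarith
    qed
    then show ?thesis by blast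
  next
    case False
    then obtain k :: nat where k: "R < of_nat k * \<bar>Re g\<bar>" using reals_Archimedean3[of "\<bar>Re g\<bar>"] by auto
    have "Re (1 * g) = - \<bar>Re g\<bar> \<or> Re (- 1 * g) = - \<bar>Re g\<bar>" by auto
    then obtain s :: complex where s: "s \<in> {1, -1}" "Re (s * g) = - \<bar>Re g\<bar>" by blast
    have "of_nat k * (s * g) \<noteq> d + of_nat N" if "d \<in> S" for d and N :: nat
    proof
      assume "of_nat k * (s * g) = d + of_nat N"
      then have "Re (of_nat k * (s * g)) = Re (d + of_nat N)" by simp
      then have "- (of_nat k * \<bar>Re g\<bar>) = Re d + of_nat N" using s(2) by simp
      with k R[OF that] abs_Re_le_cmod[of d] show False by linarith
    qed
    with s(1) show ?thesis by blast
  qed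
qed

text \<open>
  Only finitely many coefficients of \<open>a\<^sub>\<lambda> v\<close> are nonzero, so a recursion that determines each
  coefficient from the next one, without constant term, makes all of them vanish.
\<close>
lemma zero_by_descent:
  fixes y :: "nat \<Rightarrow> 'a::zero"
  assumes "\<exists>N. \<forall>n>N. y n = 0" and "\<And>n. y (Suc n) = 0 \<Longrightarrow> y n = 0"
  shows "y n = 0"
proof -
  obtain N where N: "\<And>n. n > N \<Longrightarrow> y n = 0" using assms(1) by blast
  have "y (n + Suc N) = 0" by (rule N) simp
  moreover have "y (n + k) = 0 \<Longrightarrow> y n = 0" for k
    by (induction k) (auto intro: assms(2))
  ultimately show ?thesis by blast
qed

section \<open>Coefficients of polynomials in two variables\<close>

lemma poly_subst_bound:
  assumes "\<iota> 0 = 0" "T 0 = 0" "degree P \<le> N"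
  shows "poly_subst \<iota> T P = (\<Sum>n\<le>N. (T ^^ n) (\<iota> (coeff P n)))"
proof -
  have "(T ^^ n) 0 = 0" for n by (induction n) (simp_all add: assms)
  then show ?thesis
    unfolding poly_subst_def using assms
    by (intro sum.mono_neutral_left) (auto simp: coeff_eq_0)
qed

lemma coeff_map_pCons:
  "coeff (coeff (map_poly (pCons 0) Q) j) i = (case i of 0 \<Rightarrow> 0 | Suc i' \<Rightarrow> coeff (coeff Q j) i')"
  by (simp add: coeff_map_poly coeff_pCons split: nat.splits)

lemma coeff_map_pCons_power:
  "coeff (coeff ((map_poly (pCons 0) ^^ n) Q) j) i = (if n \<le> i then coeff (coeff Q j) (i - n) else 0)"
  by (induction n arbitrary: i) (auto simp: coeff_map_pCons split: nat.splits)

lemma coeff_poly_swap: "coeff (coeff (poly_swap P) j) i = coeff (coeff P i) j"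
proof -
  have "coeff (coeff (poly_swap P) j) i =
      (\<Sum>n\<le>degree P. if n = i then coeff (coeff P n) j else 0)"
    unfolding poly_swap_def poly_subst_def coeff_sum
    by (intro sum.cong refl)
       (auto simp: coeff_map_pCons_power coeff_map_poly coeff_pCons split: nat.splits)
  then show ?thesis by (auto simp: coeff_eq_0)
qed

lemma coeff_subst_sum_power:
  fixes c :: "'m::ab_group_add"
  defines "T \<equiv> \<lambda>Q. map_poly (pCons 0) Q + pCons 0 Q"
  shows "coeff (coeff ((T ^^ n) [:[:c:]:]) j) 0 = (if n = j then c else 0)"
    and "coeff (coeff ((T ^^ n) [:[:c:]:]) j) 1 = (if n = Suc j then (\<Sum>k<n. c) else 0)"
proof -
  show *: "coeff (coeff ((T ^^ n) [:[:c:]:]) j) 0 = (if n = j then c else 0)" for n j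
    by (induction n arbitrary: j)
       (auto simp: T_def coeff_map_pCons coeff_pCons split: nat.splits)
  show "coeff (coeff ((T ^^ n) [:[:c:]:]) j) 1 = (if n = Suc j then (\<Sum>k<n. c) else 0)"
  proof (induction n arbitrary: j)
    case 0
    then show ?case by (simp add: coeff_pCons split: nat.splits)
  next
    case (Suc n)
    have "coeff (coeff ((T ^^ Suc n) [:[:c:]:]) j) 1 = coeff (coeff ((T ^^ n) [:[:c:]:]) j) 0 +
       (case j of 0 \<Rightarrow> 0 | Suc j' \<Rightarrow> coeff (coeff ((T ^^ n) [:[:c:]:]) j') 1)"
      by (simp add: T_def coeff_map_pCons coeff_pCons split: nat.splits)
    also have "\<dots> = (if Suc n = Suc j then (\<Sum>k<Suc n. c) else 0)"
      unfolding * Suc.IH by (auto split: nat.splits)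
    finally show ?case .
  qed
qed

text \<open>
  The coefficients of \<open>\<lambda>\<^sup>0\<close> and \<open>\<lambda>\<^sup>1\<close> in \<open>P(\<lambda>+\<mu>)\<close> are those that enter the
  commutators with the two lowest coefficients of an action. As the coefficients of \<open>P\<close> lie in a mere abelian group, the binomial factor \<open>j + 1\<close> is an iterated sum.
\<close>
lemma coeff_subst_sum:
  shows "coeff (coeff (subst_sum P) j) 0 = coeff P j"
    and "coeff (coeff (subst_sum P) j) 1 = (\<Sum>k<Suc j. coeff P (Suc j))"
proof -
  show "coeff (coeff (subst_sum P) j) 0 = coeff P j"
    unfolding subst_sum_def poly_subst_def coeff_sum coeff_subst_sum_power
    by (auto simp: coeff_eq_0)
  have "coeff (coeff (subst_sum P) j) 1
      = (\<Sum>n\<le>degree P. if n = Suc j then (\<Sum>k<Suc j. coeff P (Suc j)) else 0)"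
    unfolding subst_sum_def poly_subst_def coeff_sum coeff_subst_sum_power
    by (intro sum.cong) auto
  then show "coeff (coeff (subst_sum P) j) 1 = (\<Sum>k<Suc j. coeff P (Suc j))"
    by (auto simp: coeff_eq_0)
qed

section \<open>Coefficients of the action and their commutators\<close>

locale CL_module =
  lie_conformal_module CL_scale "CL_carrier \<Delta>" "CL_bracket b \<phi>" scaleV act
  for \<Delta> :: "complex set" and b :: complex and \<phi> :: "complex \<Rightarrow> complex"
    and scaleV :: "complex poly \<Rightarrow> 'v::ab_group_add \<Rightarrow> 'v" and act :: "cl \<Rightarrow> 'v \<Rightarrow> 'v poly" +
  assumes zero: "0 \<in> \<Delta>"
    and add: "\<And>\<alpha> \<beta>. \<alpha> \<in> \<Delta> \<Longrightarrow> \<beta> \<in> \<Delta> \<Longrightarrow> \<alpha> + \<beta> \<in> \<Delta>"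
    and neg: "\<And>\<alpha>. \<alpha> \<in> \<Delta> \<Longrightarrow> - \<alpha> \<in> \<Delta>"
    and b: "2 * b \<notin> \<Delta>"
    and hom: "\<And>\<alpha> \<beta>. \<alpha> \<in> \<Delta> \<Longrightarrow> \<beta> \<in> \<Delta> \<Longrightarrow> \<phi> (\<alpha> + \<beta>) = \<phi> \<alpha> + \<phi> \<beta>"
begin

abbreviation sc :: "complex \<Rightarrow> 'v \<Rightarrow> 'v" where "sc c \<equiv> scaleV [:c:]"
abbreviation D :: "'v \<Rightarrow> 'v" where "D \<equiv> scaleV [:0, 1:]"

text \<open>
  The coefficient of \<open>\<lambda>\<^sup>n\<close> in \<open>(x\<^sub>\<alpha>)\<^sub>\<lambda> v\<close>, without the factor \<open>n!\<close> that is usual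
  for the annihilation algebra.
\<close>
definition mode :: "complex \<Rightarrow> nat \<Rightarrow> 'v \<Rightarrow> 'v"
  where "mode \<alpha> n v = coeff (act (Poly_Mapping.single \<alpha> 1) v) n"

lemma b_nz: "b \<noteq> 0" using b zero by auto

lemma phi_0: "\<phi> 0 = 0" using hom[OF zero zero] by simp

lemma single_carrier: "\<alpha> \<in> \<Delta> \<Longrightarrow> Poly_Mapping.single \<alpha> p \<in> CL_carrier \<Delta>"
  by (simp add: CL_carrier_def)

sublocale C: module sc
  by unfold_locales
     (simp_all add: V.scale_right_distrib one_pCons[symmetric] mult.commute flip: V.scale_left_distrib)

lemma mode_additive: "\<alpha> \<in> \<Delta> \<Longrightarrow> additive (mode \<alpha> n)"
  by unfold_locales (simp add: mode_def act_add_right single_carrier)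

lemma mode_add: "\<alpha> \<in> \<Delta> \<Longrightarrow> mode \<alpha> n (v + w) = mode \<alpha> n v + mode \<alpha> n w"
  and mode_zero: "\<alpha> \<in> \<Delta> \<Longrightarrow> mode \<alpha> n 0 = 0"
  and mode_diff: "\<alpha> \<in> \<Delta> \<Longrightarrow> mode \<alpha> n (v - w) = mode \<alpha> n v - mode \<alpha> n w"
  using mode_additive additive.add additive.zero additive.diff by blast+

lemma mode_scale: "\<alpha> \<in> \<Delta> \<Longrightarrow> mode \<alpha> n (sc c v) = sc c (mode \<alpha> n v)"
  by (simp add: mode_def act_scale_right single_carrier coeff_map_poly)

lemma mode_D:
  "\<alpha> \<in> \<Delta> \<Longrightarrow> mode \<alpha> n (D v) = D (mode \<alpha> n v) + (case n of 0 \<Rightarrow> 0 | Suc m \<Rightarrow> mode \<alpha> m v)"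
  by (simp add: mode_def act_partial_right single_carrier coeff_map_poly coeff_pCons split: nat.splits)

lemma mode_eventually_0: "\<exists>N. \<forall>n>N. mode \<alpha> n v = 0"
  by (intro exI[of _ "degree (act (Poly_Mapping.single \<alpha> 1) v)"]) (simp add: mode_def coeff_eq_0)

lemma act_zero_left: "act 0 v = 0"
  using act_add_left[OF subspace_0[OF submodule] subspace_0[OF submodule]] by simp

text \<open>
  By sesquilinearity, \<open>p(\<partial>)\<close> in front of \<open>x\<^sub>\<alpha>\<close> turns into \<open>p(-\<lambda>)\<close>.
\<close>
lemma act_single_partial:
  assumes "\<alpha> \<in> \<Delta>"
  shows "coeff (act (Poly_Mapping.single \<alpha> p) v) n
    = (\<Sum>i\<le>n. sc (coeff p i * (-1) ^ i) (mode \<alpha> (n - i) v))"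
proof (induction p arbitrary: n)
  case 0
  show ?case by (simp add: act_zero_left)
next
  case (pCons a p)
  let ?s = "Poly_Mapping.single \<alpha>"
  have eq: "?s (pCons a p) = CL_scale [:a:] (?s 1) + CL_scale [:0, 1:] (?s p)"
    by (intro poly_mapping_eqI)
       (simp add: lookup_CL_scale lookup_add lookup_single when_def)
  have "CL_scale [:a:] (?s 1) \<in> CL_carrier \<Delta>" "CL_scale [:0, 1:] (?s p) \<in> CL_carrier \<Delta>"
    using subspace_scale[OF submodule] single_carrier[OF assms] by auto
  then have "coeff (act (?s (pCons a p)) v) n = sc a (mode \<alpha> n v) - coeff (pCons 0 (act (?s p) v)) n"
    unfolding eq using single_carrier[OF assms]
    by (simp add: act_add_left act_scale_left act_partial_left coeff_map_poly mode_def
        del: minus_pCons)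
  also have "\<dots> = (\<Sum>i\<le>n. sc (coeff (pCons a p) i * (-1) ^ i) (mode \<alpha> (n - i) v))"
  proof (cases n)
    case (Suc m)
    have "(\<Sum>i\<le>n. sc (coeff (pCons a p) i * (-1) ^ i) (mode \<alpha> (n - i) v))
        = sc a (mode \<alpha> n v) + (\<Sum>i\<le>m. - sc (coeff p i * (-1) ^ i) (mode \<alpha> (m - i) v))"
      unfolding Suc sum.atMost_Suc_shift by (simp flip: C.scale_minus_left)
    then show ?thesis by (simp add: Suc pCons.IH sum_negf)
  qed simp
  finally show ?case .
qed

text \<open>
  The part of the structure constant of \<open>[x\<^sub>\<alpha> \<^sub>\<lambda> x\<^sub>\<beta>]\<close> that is free of \<open>\<partial>\<close> and
  \<open>\<lambda>\<close>.
\<close>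
definition struct_const :: "complex \<Rightarrow> complex \<Rightarrow> complex"
  where "struct_const \<alpha> \<beta> = (1 / b) * (\<phi> \<alpha> * \<beta> - \<phi> \<beta> * \<alpha> + b * (\<phi> \<alpha> - \<phi> \<beta>))"

text \<open>
  Since \<open>\<partial>\<close> acts as \<open>-\<lambda>-\<mu>\<close> inside \<open>[a\<^sub>\<lambda> b]\<^bsub>\<lambda>+\<mu>\<^esub>\<close>, the module axiom says that
  the commutator of \<open>(x\<^sub>\<alpha>)\<^sub>\<lambda>\<close> and \<open>(x\<^sub>\<beta>)\<^sub>\<mu>\<close> is
  \<open>((\<beta>+b)\<lambda> - (\<alpha>+b)\<mu> + c) (x\<^bsub>\<alpha>+\<beta>\<^esub>)\<^bsub>\<lambda>+\<mu>\<^esub>\<close>. Its coefficients at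
  \<open>\<lambda>\<^sup>0 \<mu>\<^sup>n\<close> and \<open>\<lambda>\<^sup>1 \<mu>\<^sup>n\<close> are the following two formulas.
\<close>
lemma
  assumes \<alpha>: "\<alpha> \<in> \<Delta>" and \<beta>: "\<beta> \<in> \<Delta>"
  shows mode_commutator_0: "mode \<alpha> 0 (mode \<beta> n v) = mode \<beta> n (mode \<alpha> 0 v)
      + sc (struct_const \<alpha> \<beta>) (mode (\<alpha> + \<beta>) n v)
      - (case n of 0 \<Rightarrow> 0 | Suc m \<Rightarrow> sc (\<alpha> + b) (mode (\<alpha> + \<beta>) m v))"
    and mode_commutator_1: "mode \<alpha> 1 (mode \<beta> n v) = mode \<beta> n (mode \<alpha> 1 v)
      + sc (of_nat (Suc n) * struct_const \<alpha> \<beta>) (mode (\<alpha> + \<beta>) (Suc n) v)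
      + sc (\<beta> + b - of_nat n * (\<alpha> + b)) (mode (\<alpha> + \<beta>) n v)"
proof -
  let ?s = "Poly_Mapping.single :: _ \<Rightarrow> _ \<Rightarrow> cl" and ?\<gamma> = "\<alpha> + \<beta>"
  let ?a = "?s \<alpha> 1" and ?b = "?s \<beta> 1"
  let ?c0 = "?s ?\<gamma> [:struct_const \<alpha> \<beta>, \<alpha> + b:]" and ?c1 = "?s ?\<gamma> [:\<alpha> + \<beta> + 2 * b:]"
  have \<gamma>: "?\<gamma> \<in> \<Delta>" using add \<alpha> \<beta> by blast
  have ss0: "subst_sum 0 = (0 :: 'v poly poly)"
    by (simp add: subst_sum_def poly_subst_def)
  have "lam_plus_mu act (CL_bracket b \<phi> ?a ?b) v
      = subst_sum (act ?c0 v) + map_poly (pCons 0) (subst_sum (act ?c1 v))"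
    unfolding CL_bracket_basis lam_plus_mu_def struct_const_def[symmetric]
    by (subst poly_subst_bound[where N = 1]) (simp_all add: act_zero_left ss0)
  moreover have "lam_plus_mu act (CL_bracket b \<phi> ?a ?b) v = lam_mu act ?a ?b v - mu_lam act ?b ?a v"
    by (rule act_bracket) (simp_all add: single_carrier \<alpha> \<beta>)
  ultimately have eq: "coeff (coeff (subst_sum (act ?c0 v) + map_poly (pCons 0) (subst_sum (act ?c1 v))) j) i
      = coeff (coeff (lam_mu act ?a ?b v - mu_lam act ?b ?a v) j) i" for i j
    by simp
  have a0: "act ?a 0 = 0" "act ?b 0 = 0"
    using act_add_right[OF single_carrier, of _ 1 0 0] \<alpha> \<beta> by simp_all
  have rhs: "coeff (coeff (lam_mu act ?a ?b v - mu_lam act ?b ?a v) j) i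
      = mode \<alpha> i (mode \<beta> j v) - mode \<beta> j (mode \<alpha> i v)" for i j
    by (simp add: lam_mu_def mu_lam_def coeff_poly_swap coeff_map_poly a0 mode_def)
  have c0: "coeff (act ?c0 v) n = sc (struct_const \<alpha> \<beta>) (mode ?\<gamma> n v)
      - (case n of 0 \<Rightarrow> 0 | Suc m \<Rightarrow> sc (\<alpha> + b) (mode ?\<gamma> m v))" for n
  proof (cases n)
    case (Suc m)
    have "(\<Sum>i\<le>Suc m. sc (coeff [:struct_const \<alpha> \<beta>, \<alpha> + b:] i * (-1) ^ i) (mode ?\<gamma> (Suc m - i) v))
        = (\<Sum>i\<in>{0, 1}. sc (coeff [:struct_const \<alpha> \<beta>, \<alpha> + b:] i * (-1) ^ i) (mode ?\<gamma> (Suc m - i) v))"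
      by (intro sum.mono_neutral_right) (auto simp: coeff_pCons split: nat.splits)
    then show ?thesis
      using Suc by (simp add: act_single_partial[OF \<gamma>] del: sum.atMost_Suc flip: V.scale_minus_left)
  qed (simp add: act_single_partial[OF \<gamma>])
  have c1: "coeff (act ?c1 v) n = sc (\<alpha> + \<beta> + 2 * b) (mode ?\<gamma> n v)" for n
  proof -
    have "(\<Sum>i\<le>n. sc (coeff [:\<alpha> + \<beta> + 2 * b:] i * (-1) ^ i) (mode ?\<gamma> (n - i) v))
        = (\<Sum>i\<in>{0}. sc (coeff [:\<alpha> + \<beta> + 2 * b:] i * (-1) ^ i) (mode ?\<gamma> (n - i) v))"
      by (intro sum.mono_neutral_right) (auto simp: coeff_pCons split: nat.splits)
    then show ?thesis by (simp add: act_single_partial[OF \<gamma>])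
  qed
  show "mode \<alpha> 0 (mode \<beta> n v) = mode \<beta> n (mode \<alpha> 0 v)
      + sc (struct_const \<alpha> \<beta>) (mode (\<alpha> + \<beta>) n v)
      - (case n of 0 \<Rightarrow> 0 | Suc m \<Rightarrow> sc (\<alpha> + b) (mode (\<alpha> + \<beta>) m v))"
    using eq[of n 0] unfolding rhs by (simp add: coeff_subst_sum coeff_map_pCons c0 algebra_simps)
  have mult: "(\<Sum>k<m. w) = sc (of_nat m) w" for m w
    by (induction m) (simp_all add: one_pCons[symmetric] add.commute flip: V.scale_left_distrib
       add: C.scale_left_distrib)
  have "mode \<alpha> 1 (mode \<beta> n v) - mode \<beta> n (mode \<alpha> 1 v)
      = sc (of_nat (Suc n)) (sc (struct_const \<alpha> \<beta>) (mode ?\<gamma> (Suc n) v) - sc (\<alpha> + b) (mode ?\<gamma> n v))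
        + sc (\<alpha> + \<beta> + 2 * b) (mode ?\<gamma> n v)"
    using eq[of n 1] unfolding rhs coeff_add coeff_subst_sum coeff_map_pCons mult
    by (simp add: coeff_subst_sum c0 c1)
  also have "\<dots> = sc (of_nat (Suc n) * struct_const \<alpha> \<beta>) (mode ?\<gamma> (Suc n) v)
      + sc (\<alpha> + \<beta> + 2 * b - of_nat (Suc n) * (\<alpha> + b)) (mode ?\<gamma> n v)"
    by (simp only: C.scale_right_diff_distrib C.scale_scale C.scale_left_diff_distrib) simp
  also have "\<alpha> + \<beta> + 2 * b - of_nat (Suc n) * (\<alpha> + b) = \<beta> + b - of_nat n * (\<alpha> + b)"
    by (simp add: algebra_simps)
  finally show "mode \<alpha> 1 (mode \<beta> n v) = mode \<beta> n (mode \<alpha> 1 v)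
      + sc (of_nat (Suc n) * struct_const \<alpha> \<beta>) (mode (\<alpha> + \<beta>) (Suc n) v)
      + sc (\<beta> + b - of_nat n * (\<alpha> + b)) (mode (\<alpha> + \<beta>) n v)"
    by (simp add: algebra_simps)
qed

text \<open>
  Up to the factor \<open>b\<close>, the element \<open>x\<^sub>0\<close> spans a Virasoro conformal algebra, in which \<open>E\<close> and
  \<open>H\<close> play the roles of \<open>L\<^bsub>-1\<^esub>\<close> and \<open>L\<^sub>0\<close>.
\<close>
abbreviation E :: "'v \<Rightarrow> 'v" where "E \<equiv> mode 0 0"
abbreviation H :: "'v \<Rightarrow> 'v" where "H \<equiv> mode 0 (Suc 0)"
text \<open>
  The difference between \<open>E\<close> and the operator \<open>b \<partial>\<close>, which has the same commutators with the
  coefficients of the action of \<open>x\<^sub>0\<close>. Hence \<open>T\<close> commutes with \<open>\<partial>\<close> and with these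
  coefficients; on a free module of rank one with nonzero action it is a scalar.
\<close>
definition T :: "'v \<Rightarrow> 'v" where "T v = E v - sc b (D v)"

lemma struct_const_0: "struct_const 0 \<beta> = - \<phi> \<beta>"
  using b_nz by (simp add: struct_const_def phi_0)

lemma E_mode: "\<beta> \<in> \<Delta> \<Longrightarrow> E (mode \<beta> n v) = mode \<beta> n (E v) - sc (\<phi> \<beta>) (mode \<beta> n v)
    - (case n of 0 \<Rightarrow> 0 | Suc m \<Rightarrow> sc b (mode \<beta> m v))"
  using mode_commutator_0[OF zero, of \<beta> n v]
  by (simp add: struct_const_0 C.scale_minus_left del: minus_pCons cong: nat.case_cong)

lemma H_mode: "\<beta> \<in> \<Delta> \<Longrightarrow> \<phi> \<beta> = 0 \<Longrightarrow>
    H (mode \<beta> n v) = mode \<beta> n (H v) + sc (\<beta> + b - of_nat n * b) (mode \<beta> n v)"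
  using mode_commutator_1[OF zero, of \<beta> n v] by (simp add: struct_const_0)

lemma H_E: "H (E v) = E (H v) + sc b (E v)"
  using H_mode[OF zero phi_0, of 0 v] by simp

lemma E_D: "E (D v) = D (E v)"
  by (simp add: mode_D zero)

lemma H_D: "H (D v) = D (H v) + E v"
  by (simp add: mode_D zero)

lemma sc_D: "D (sc c v) = sc c (D v)"
  by (rule V.scale_left_commute)

lemma D_add: "D (v + w) = D v + D w"
  by (rule V.scale_right_distrib)

lemma T_add: "T (v + w) = T v + T w"
  by (simp only: T_def mode_add[OF zero] D_add C.scale_right_distrib) simp

lemma T_sc: "T (sc c v) = sc c (T v)"
  by (simp only: T_def mode_scale[OF zero] sc_D C.scale_right_diff_distrib C.scale_left_commute[of b])

lemma T_mode:
  assumes "\<beta> \<in> \<Delta>"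
  shows "T (mode \<beta> n v) = mode \<beta> n (T v) - sc (\<phi> \<beta>) (mode \<beta> n v)"
proof -
  have "mode \<beta> n (T v) = mode \<beta> n (E v) - sc b (D (mode \<beta> n v))
      - sc b (case n of 0 \<Rightarrow> 0 | Suc m \<Rightarrow> mode \<beta> m v)"
    by (simp only: T_def mode_diff[OF assms] mode_scale[OF assms] mode_D[OF assms] C.scale_right_distrib) simp
  then show ?thesis
    unfolding T_def E_mode[OF assms] by (cases n) (simp_all del: V.scale_scale)
qed

lemma T_E: "T (E v) = E (T v)" and T_H: "T (H v) = H (T v)"
  using T_mode[OF zero, of _ v] by (simp_all add: phi_0)

lemma T_D: "T (D v) = D (T v)"
  by (simp only: T_def E_D V.scale_right_diff_distrib sc_D)

lemma scaleV_pCons: "scaleV (pCons a p) v = sc a v + D (scaleV p v)"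
proof -
  have "pCons a p = [:a:] + [:0, 1:] * p" by simp
  then show ?thesis by (simp only: V.scale_left_distrib V.scale_scale)
qed

lemma scaleV_commute:
  assumes "additive F" "\<And>c v. F (sc c v) = sc c (F v)" "\<And>v. F (D v) = D (F v)"
  shows "F (scaleV p v) = scaleV p (F v)"
proof (induction p)
  case (pCons a p)
  then show ?case
    by (simp only: scaleV_pCons[of a p] assms(2,3) additive.add[OF assms(1)])
qed (simp add: additive.zero[OF assms(1)])

lemma E_scaleV: "E (scaleV p v) = scaleV p (E v)"
  by (rule scaleV_commute[OF mode_additive[OF zero] mode_scale[OF zero] E_D])

lemma additive_T: "additive T"
  by unfold_locales (rule T_add)

lemma T_scaleV: "T (scaleV p v) = scaleV p (T v)"
  by (rule scaleV_commute[OF additive_T T_sc T_D])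

lemma H_scaleV: "H (scaleV p v) = scaleV p (H v) + scaleV (pderiv p) (E v)"
proof (induction p)
  case 0
  then show ?case by (simp add: mode_zero zero)
next
  case (pCons a p)
  have "H (scaleV (pCons a p) v) = sc a (H v) + D (scaleV p (H v)) + D (scaleV (pderiv p) (E v)) + scaleV p (E v)"
    by (simp only: scaleV_pCons[of a p] mode_add[OF zero] mode_scale[OF zero] H_D pCons.IH D_add E_scaleV add.assoc)
  also have "\<dots> = scaleV (pCons a p) (H v) + scaleV (pderiv (pCons a p)) (E v)"
    unfolding pderiv_pCons V.scale_left_distrib scaleV_pCons[of a p] scaleV_pCons[of 0 "pderiv p"]
    by simp
  finally show ?case .
qed

sublocale E: module_endo sc E
  by unfold_locales (simp_all add: mode_add mode_scale zero)

sublocale H: module_endo sc H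
  by unfold_locales (simp_all add: mode_add mode_scale zero)

sublocale T: module_endo sc T
  by unfold_locales (simp_all only: T_add T_sc)

sublocale TD: module_endo scaleV T
  by unfold_locales (simp_all only: T_add T_scaleV)

section \<open>Torsion over the polynomials in E\<close>

text \<open>
  The relation \<open>E (x\<^sub>\<beta>)\<^sub>\<mu> = (x\<^sub>\<beta>)\<^sub>\<mu> E - (b \<mu> + \<phi>(\<beta>)) (x\<^sub>\<beta>)\<^sub>\<mu>\<close> moves
  \<open>f(E)\<close> to the left as \<open>f(E + b \<mu> + \<phi>(\<beta>))\<close>, whose leading coefficient in \<open>\<mu>\<close> is a nonzero
  number; so it annihilates no nonzero polynomial in \<open>\<mu>\<close>. The proof does this for one linear
  factor of \<open>f\<close> at a time. In particular, the elements on which everything acts as zero are exactly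
  the kernel of \<open>E\<close>, and modulo this kernel the module is torsion-free over \<open>\<complex>[E]\<close>.
\<close>
lemma mode_zero_if_E_poly:
  assumes \<beta>: "\<beta> \<in> \<Delta>" and "f \<noteq> 0" and "\<And>n. mode \<beta> n (E.app f v) = 0"
  shows "mode \<beta> n v = 0"
  using assms(2,3)
proof (induction "degree f" arbitrary: f v n)
  case 0
  then obtain c where "f = [:c:]" "c \<noteq> 0" by (metis degree_eq_zeroE pCons_0_0)
  with 0(3)[of n] have "sc c (mode \<beta> n v) = 0" "c \<noteq> 0"
    by (simp_all add: E.app_const mode_scale \<beta> del: V.scale_scale)
  then have "sc (inverse c) (sc c (mode \<beta> n v)) = 0" by simp
  with \<open>c \<noteq> 0\<close> show ?case by (simp add: one_pCons[symmetric])
next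
  case (Suc d)
  then obtain r where "poly f r = 0"
    using fundamental_theorem_of_algebra[of f] by (auto simp: constant_degree)
  then obtain g where f: "f = [:- r, 1:] * g" by (auto simp: poly_eq_0_iff_dvd)
  with Suc.prems(1) have g: "g \<noteq> 0" by auto
  then have "degree f = Suc (degree g)" unfolding f by (subst degree_mult_eq) auto
  with Suc.hyps(2) have d: "d = degree g" by simp
  let ?w = "E.app g v"
  have "mode \<beta> n ?w = 0" for n
  proof (rule zero_by_descent[OF mode_eventually_0])
    fix n assume *: "mode \<beta> (Suc n) ?w = 0"
    have "E.app f v = E ?w - sc r ?w"
      unfolding f E.app_mult by (simp add: E.app_pCons one_pCons[symmetric] C.scale_minus_left
          del: minus_pCons E.poly.scale_scale)
    with Suc.prems(2)[of "Suc n"] * have "mode \<beta> (Suc n) (E ?w) = 0"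
      by (simp add: mode_diff mode_scale \<beta>)
    with E_mode[OF \<beta>, of "Suc n" ?w] * have "sc b (mode \<beta> n ?w) = 0"
      by (simp add: mode_zero zero)
    then have "sc (inverse b) (sc b (mode \<beta> n ?w)) = 0" by simp
    then show "mode \<beta> n ?w = 0" using b_nz by (simp add: one_pCons[symmetric])
  qed
  then show ?case by (rule Suc.hyps(1)[OF d g])
qed

lemma E_poly_torsion:
  assumes "f \<noteq> 0" "E.app f v = 0" "\<beta> \<in> \<Delta>"
  shows "mode \<beta> n v = 0"
  using mode_zero_if_E_poly[OF assms(3,1)] assms by (simp add: mode_zero)

lemma app_E_monom: "E.app (monom 1 l) v = (E ^^ l) v"
  by (induction l) (simp_all add: monom_Suc E.app_pCons E.app_const monom_0 flip: one_pCons)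

lemma mode_zero_if_E_zero: "E v = 0 \<Longrightarrow> \<beta> \<in> \<Delta> \<Longrightarrow> mode \<beta> n v = 0"
  using E_poly_torsion[of "monom 1 1" v] by (simp add: app_E_monom)

lemma E_power_zero: "(E ^^ l) (E v) = 0 \<Longrightarrow> E v = 0"
  using E_poly_torsion[of "monom 1 (Suc l)" v 0 0] zero
  by (simp add: app_E_monom funpow_Suc_right del: funpow.simps)

lemma E_E_zero: "E (E v) = 0 \<Longrightarrow> E v = 0"
  using E_power_zero[of 1 v] by simp

section \<open>The eigenvalues of T\<close>

lemma E_TD_app: "E (TD.app P v) = TD.app P (E v)"
  by (induction P) (simp_all add: TD.app_pCons mode_add zero mode_zero E_scaleV flip: T_E)

lemma H_TD_app: "H (TD.app P v) = TD.app P (H v) + TD.app (map_poly pderiv P) (E v)"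
  by (induction P)
     (simp_all add: TD.app_pCons mode_add zero mode_zero H_scaleV map_poly_pCons T_add flip: T_H)

text \<open>
  The commutator with \<open>H\<close> differentiates in \<open>\<partial>\<close>, up to the factor \<open>E\<close>, because
  \<open>[H, \<partial>] = E\<close> and \<open>[H, T] = 0\<close>. The factor \<open>E\<close> can be cancelled since the kernels of
  \<open>E\<close> and \<open>E\<^sup>2\<close> agree.
\<close>
lemma E_annihilates_pderiv:
  assumes "\<And>v. E (TD.app P v) = 0"
  shows "E (TD.app (map_poly pderiv P) v) = 0"
proof -
  have "0 = H (E (TD.app P v))"
    by (simp add: assms mode_zero zero)
  also have "\<dots> = E (H (TD.app P v)) + sc b (E (TD.app P v))"
    by (rule H_E)
  also have "\<dots> = E (TD.app P (H v)) + E (TD.app (map_poly pderiv P) (E v))"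
    by (simp add: assms H_TD_app mode_add zero)
  also have "\<dots> = E (E (TD.app (map_poly pderiv P) v))"
    by (simp only: assms E_TD_app[of "map_poly pderiv P"] add_0)
  finally show ?thesis by (metis E_E_zero)
qed

text \<open>
  Differentiate the coefficients until they are constant.
\<close>
lemma ex_const_coeffs_annihilated:
  assumes "P \<noteq> 0" "\<And>v. E (TD.app P v) = 0"
  shows "\<exists>q. q \<noteq> 0 \<and> (\<forall>v. E (T.app q v) = 0)"
proof -
  have "\<exists>k. \<forall>i. degree (coeff P i) \<le> k"
  proof (intro exI allI)
    fix i
    show "degree (coeff P i) \<le> (\<Sum>i\<le>degree P. degree (coeff P i))"
    proof (cases "i \<le> degree P")
      case True
      then show ?thesis by (intro member_le_sum) auto
    qed (simp add: coeff_eq_0)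
  qed
  then obtain k where "\<forall>i. degree (coeff P i) \<le> k" by blast
  then show ?thesis using assms
  proof (induction k arbitrary: P)
    case 0
    let ?q = "map_poly (\<lambda>p. coeff p 0) P"
    have const: "coeff P i = [:coeff ?q i:]" for i
    proof -
      have "degree (coeff P i) = 0" using 0(1) by simp
      then obtain a where "coeff P i = [:a:]" by (rule degree_eq_zeroE)
      then show ?thesis by (simp add: coeff_map_poly)
    qed
    have q: "?q \<noteq> 0"
    proof
      assume "?q = 0"
      with const have "coeff P i = 0" for i by simp
      then show False using 0(2) by (simp add: poly_eq_iff)
    qed
    have "degree ?q = degree P"
    proof (rule antisym)
      show "degree P \<le> degree ?q"
        by (intro degree_le allI impI) (simp only: const coeff_eq_0 pCons_0_0)
    qed (simp add: degree_le coeff_map_poly coeff_eq_0)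
    then have "T.app ?q v = TD.app P v" for v
      by (simp only: op_poly_def const)
    with 0(3) q show ?case by (intro exI[of _ ?q]) simp
  next
    case (Suc k)
    show ?case
    proof (cases "map_poly pderiv P = 0")
      case True
      then have "pderiv (coeff P i) = 0" for i by (metis coeff_0 coeff_map_poly pderiv_0)
      then have "\<forall>i. degree (coeff P i) \<le> k" by (simp add: pderiv_eq_0_iff)
      with Suc show ?thesis by blast
    next
      case False
      have "\<forall>i. degree (coeff (map_poly pderiv P) i) \<le> k"
        using Suc.prems(1) by (auto simp: coeff_map_poly degree_pderiv le_diff_conv)
      with Suc.IH[OF this False] E_annihilates_pderiv[OF Suc.prems(3)] show ?thesis by blast
    qed
  qed
qed

text \<open>
  Modulo the kernel of \<open>E\<close>, the operator \<open>T\<close> has finitely many eigenvalues, all of them constants: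
  a Cayley-Hamilton relation over \<open>\<complex>[\<partial>]\<close> can be made independent of \<open>\<partial>\<close>.
\<close>
lemma ex_poly_T:
  assumes "finite B" "V.span B = UNIV"
  shows "\<exists>q. q \<noteq> 0 \<and> (\<forall>v. E (T.app q v) = 0)"
proof -
  have U: "V.span (B \<union> {0}) = UNIV"
    using V.span_mono[of B "B \<union> {0}"] assms by auto
  have "\<exists>P. P \<noteq> 0 \<and> (\<forall>v \<in> V.span (B \<union> {0}). TD.app P v \<in> {0})"
    using assms(1) by (intro poly_annihilating_endo_relative TD.module_endo_axioms)
      (auto simp: V.subspace_def U[simplified])
  then obtain P where "P \<noteq> 0" "\<And>v. TD.app P v = 0" unfolding U by auto
  then show ?thesis by (intro ex_const_coeffs_annihilated[of P]) (simp_all add: mode_zero zero)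
qed

section \<open>The image of E as a finitely generated module over the polynomials in E\<close>

text \<open>
  The image of \<open>E\<close> is isomorphic to the module modulo the kernel of \<open>E\<close>, so it replaces this
  quotient. As \<open>\<partial> = (E - T) / b\<close> and \<open>T\<close> is integral over \<open>\<complex>\<close> on this image,
  \<open>\<complex>[\<partial>]\<close>-generators \<open>g\<close> give the \<open>\<complex>[E]\<close>-generators \<open>E T\<^sup>j g\<close>.
\<close>
lemma range_E_fin_gen:
  assumes B: "finite B" "V.span B = UNIV" and q: "q \<noteq> 0" "\<And>v. E (T.app q v) = 0"
  shows "\<exists>B1. finite B1 \<and> B1 \<subseteq> range E \<and> range E \<subseteq> E.poly.span B1"
proof -
  let ?d = "degree q"
  define B1 where "B1 = (\<lambda>(j, g). E ((T ^^ j) g)) ` ({..<?d} \<times> B)"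
  let ?S = "E.poly.span B1"
  have sc: "sc c w \<in> ?S" if "w \<in> ?S" for c w
    using E.poly.span_scale[OF that, of "[:c:]"] by (simp add: E.app_const)
  have Ecl: "E w \<in> ?S" if "w \<in> ?S" for w
    using E.poly.span_scale[OF that, of "[:0, 1:]"] by (simp add: E.app_pCons flip: one_pCons)
  have base: "E ((T ^^ j) g) \<in> ?S" if "j < ?d" "g \<in> B" for j g
    using that unfolding B1_def by (intro E.poly.span_base) force
  \<comment> \<open>The leading coefficient of \<open>q\<close> is invertible, so \<open>E (q(T) g) = 0\<close> reduces the next power of \<open>T\<close>.\<close>
  have top: "E ((T ^^ ?d) g) \<in> ?S" if g: "g \<in> B" for g
  proof -
    have "0 = E (T.app q g)" by (simp add: q)
    also have "\<dots> = (\<Sum>i<?d. sc (coeff q i) (E ((T ^^ i) g))) + sc (lead_coeff q) (E ((T ^^ ?d) g))"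
      by (simp add: op_poly_def E.A_add E.A_sum E.A_scale flip: lessThan_Suc_atMost)
    finally have "sc (lead_coeff q) (E ((T ^^ ?d) g)) = - (\<Sum>i<?d. sc (coeff q i) (E ((T ^^ i) g)))"
      by (simp add: eq_neg_iff_add_eq_0 add.commute)
    also have "\<dots> \<in> ?S"
      using g by (intro E.poly.span_neg E.poly.span_sum sc base) auto
    finally have "sc (inverse (lead_coeff q)) (sc (lead_coeff q) (E ((T ^^ ?d) g))) \<in> ?S" by (rule sc)
    then show ?thesis using q by (simp add: one_pCons[symmetric])
  qed
  have le: "E ((T ^^ j) g) \<in> ?S" if "j \<le> ?d" "g \<in> B" for j g
    using that base top by (cases "j = ?d") auto
  have T_app: "T (E.app p w) = E.app p (T w)" for p w
    by (induction p) (simp_all add: E.app_pCons T_add T_sc T_E)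
  have "E.poly.subspace {w. T w \<in> ?S}"
    by (rule E.poly.subspaceI)
       (auto simp: T_add T_app intro: E.poly.span_zero E.poly.span_add E.poly.span_scale)
  moreover have "B1 \<subseteq> {w. T w \<in> ?S}"
  proof -
    have "T (E ((T ^^ j) g)) \<in> ?S" if "j < ?d" "g \<in> B" for j g
      using le[of "Suc j" g] that by (simp add: T_E)
    then show ?thesis by (auto simp: B1_def)
  qed
  ultimately have "?S \<subseteq> {w. T w \<in> ?S}" by (intro E.poly.span_minimal)
  then have Tcl: "T w \<in> ?S" if "w \<in> ?S" for w using that by blast
  have Dcl: "D w \<in> ?S" if "w \<in> ?S" for w
  proof -
    have "sc (1 / b) (E w - T w) \<in> ?S" by (intro sc E.poly.span_diff Ecl Tcl that)
    moreover have "sc (1 / b) (E w - T w) = D w"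
      using b_nz by (simp add: T_def)
    ultimately show ?thesis by simp
  qed
  have pcl: "scaleV p w \<in> ?S" if "w \<in> ?S" for p w
  proof (induction p)
    case (pCons a p)
    show ?case unfolding scaleV_pCons[of a p] by (intro E.poly.span_add sc that Dcl pCons.IH)
  qed (simp add: E.poly.span_zero)
  have "V.subspace {v. E v \<in> ?S}"
    by (rule V.subspaceI)
       (auto simp: mode_zero mode_add zero E_scaleV intro: E.poly.span_zero E.poly.span_add pcl)
  moreover have "B \<subseteq> {v. E v \<in> ?S}" using le[of 0] by auto
  ultimately have "V.span B \<subseteq> {v. E v \<in> ?S}" by (intro V.span_minimal)
  then have "range E \<subseteq> ?S" using B by auto
  moreover have "finite B1" "B1 \<subseteq> range E" using B by (auto simp: B1_def)
  ultimately show ?thesis by blast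
qed

lemma range_E_power_subspace: "C.subspace (range (E ^^ l))"
proof (rule C.subspaceI)
  show "0 \<in> range (E ^^ l)"
    using E.power_scale[of l 0 0] by (intro range_eqI[of _ _ 0]) simp
next
  fix x y assume "x \<in> range (E ^^ l)" "y \<in> range (E ^^ l)"
  then show "x + y \<in> range (E ^^ l)" by (auto simp flip: E.power_add)
next
  fix c x assume "x \<in> range (E ^^ l)"
  then show "sc c x \<in> range (E ^^ l)" by (auto simp only: image_iff E.power_scale[symmetric])
qed

lemma H_E_power: "H ((E ^^ l) v) = (E ^^ l) (H v) + sc (of_nat l * b) ((E ^^ l) v)"
proof (induction l)
  case (Suc l)
  have "H ((E ^^ Suc l) v) = E (H ((E ^^ l) v)) + sc b ((E ^^ Suc l) v)"
    by (simp add: H_E)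
  also have "\<dots> = (E ^^ Suc l) (H v) + (sc (of_nat l * b) ((E ^^ Suc l) v) + sc b ((E ^^ Suc l) v))"
    by (simp add: Suc.IH mode_add mode_scale zero)
  also have "\<dots> = (E ^^ Suc l) (H v) + sc (of_nat (Suc l) * b) ((E ^^ Suc l) v)"
    by (simp add: algebra_simps flip: C.scale_left_distrib)
  finally show ?case .
qed simp

lemma H_range_E_power:
  assumes "w \<in> range (E ^^ l)"
  shows "H w \<in> range (E ^^ l)"
proof -
  from assms obtain u where "w = (E ^^ l) u" by blast
  then have "H w = (E ^^ l) (H u + sc (of_nat l * b) u)"
    by (simp only: H_E_power E.power_add E.power_scale)
  then show ?thesis by blast
qed

text \<open>
  The space \<open>range E / range (E\<^sup>2)\<close> is spanned by finitely many generators over \<open>\<complex>\<close> and is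
  preserved by \<open>H\<close>. The roots of \<open>h\<close> are the lowest weights of the module, all other weights
  being obtained from them by adding nonnegative integer multiples of \<open>b\<close>.
\<close>
lemma ex_poly_H:
  assumes B1: "finite B1" "B1 \<subseteq> range E" "range E \<subseteq> E.poly.span B1"
  shows "\<exists>h. h \<noteq> 0 \<and> (\<forall>v. \<exists>w. H.app h (E v) = E (E w))"
proof -
  let ?K = "range (\<lambda>w. E (E w))" and ?S = "C.span (B1 \<union> range (\<lambda>w. E (E w)))"
  have K: "C.subspace ?K" "\<And>w. w \<in> ?K \<Longrightarrow> H w \<in> ?K"
    using range_E_power_subspace[of 2] H_range_E_power[of _ 2]
    by (simp_all add: numeral_2_eq_2 o_def)
  have R: "C.subspace (range E)" "\<And>w. w \<in> range E \<Longrightarrow> H w \<in> range E"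
    using range_E_power_subspace[of 1] H_range_E_power[of _ 1] by simp_all
  have S1: "?S \<subseteq> range E" using B1 R(1) by (intro C.span_minimal) auto
  have "E w \<in> ?S" if "w \<in> ?S" for w
    using S1 that by (auto intro!: C.span_base)
  then have "E.poly.subspace ?S"
    by (intro E.poly.subspaceI) (auto intro: C.span_zero C.span_add E.app_mem[OF C.subspace_span])
  then have "E.poly.span B1 \<subseteq> ?S"
    by (intro E.poly.span_minimal) (auto intro: C.span_base)
  with S1 B1 have S: "?S = range E" by blast
  have "H w \<in> ?S" if "w \<in> ?S" for w using that R(2) S by simp
  then obtain h where "h \<noteq> 0" "\<forall>v\<in>?S. H.app h v \<in> ?K"
    using poly_annihilating_endo_relative[OF H.module_endo_axioms B1(1) K] by blast
  then show ?thesis unfolding S by (intro exI[of _ h]) blast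
qed

text \<open>
  If \<open>w\<close> is divisible by all powers of \<open>E\<close>, choose \<open>z\<^sub>l\<close> with \<open>w = E\<^sup>l z\<^sub>l\<close>. The ascending
  chain condition gives \<open>z\<^sub>k = E r(E) z\<^sub>k\<close> for some \<open>k\<close> and \<open>r\<close>, so \<open>z\<^sub>k\<close> is a torsion
  element.
\<close>
lemma E_adic_separated:
  assumes B1: "finite B1" "range E \<subseteq> E.poly.span B1" and w: "\<And>l. w \<in> range (E ^^ l)"
  shows "w = 0"
proof -
  have "\<forall>l. \<exists>v. w = (E ^^ l) (E v)"
    using w[of "Suc _"] by (auto simp: image_iff funpow_Suc_right simp del: funpow.simps)
  then obtain v where v: "\<And>l. w = (E ^^ l) (E (v l))" by metis
  define z where "z l = E (v l)" for l
  have zw: "(E ^^ l) (z l) = w" for l using v by (simp add: z_def)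
  have z: "z l = E (z (Suc l))" for l
  proof -
    have "(E ^^ l) (E (v l - z (Suc l))) = (E ^^ l) (z l) - (E ^^ Suc l) (z (Suc l))"
      by (simp add: mode_diff zero additive.diff[OF additive.intro, of "E ^^ l"] E.power_add z_def
          funpow_Suc_right del: funpow.simps)
    also have "\<dots> = 0" unfolding zw by simp
    finally have "E (v l - z (Suc l)) = 0" by (rule E_power_zero)
    then show ?thesis by (simp add: mode_diff zero z_def)
  qed
  have zz: "z i = (E ^^ d) (z (i + d))" for i d
    by (induction d) (simp_all add: funpow_Suc_right z[symmetric] del: funpow.simps(2))
  have "z i \<in> E.poly.span (B1 \<union> {})" for i using B1(2) by (auto simp: z_def)
  from sequence_in_fin_gen_module[where u = z, OF E.poly.module_axioms B1(1) this]
  obtain k where "z k \<in> E.poly.span (z ` {..<k})" by auto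
  moreover have "E.poly.span (z ` {..<k}) \<subseteq> range (\<lambda>r. E.app (pCons 0 r) (z k))"
  proof (rule E.poly.span_minimal)
    show "z ` {..<k} \<subseteq> range (\<lambda>r. E.app (pCons 0 r) (z k))"
    proof
      fix y assume "y \<in> z ` {..<k}"
      then obtain i where "i < k" "y = z i" by auto
      moreover have "k = i + Suc (k - i - 1)" using \<open>i < k\<close> by simp
      ultimately have "y = E.app (monom 1 (Suc (k - i - 1))) (z k)"
        using zz[of i "Suc (k - i - 1)"] by (simp only: app_E_monom)
      then show "y \<in> range (\<lambda>r. E.app (pCons 0 r) (z k))" by (auto simp: monom_Suc)
    qed
    show "E.poly.subspace (range (\<lambda>r. E.app (pCons 0 r) (z k)))"
    proof (rule E.poly.subspaceI)
      show "0 \<in> range (\<lambda>r. E.app (pCons 0 r) (z k))" by (rule range_eqI[of _ _ 0]) simp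
    next
      fix x y assume "x \<in> range (\<lambda>r. E.app (pCons 0 r) (z k))" "y \<in> range (\<lambda>r. E.app (pCons 0 r) (z k))"
      then obtain r s where "x = E.app (pCons 0 r) (z k)" "y = E.app (pCons 0 s) (z k)" by auto
      then have "x + y = E.app (pCons 0 (r + s)) (z k)" by (simp flip: E.app_add_left)
      then show "x + y \<in> range (\<lambda>r. E.app (pCons 0 r) (z k))" by blast
    next
      fix c x assume "x \<in> range (\<lambda>r. E.app (pCons 0 r) (z k))"
      then obtain r where "x = E.app (pCons 0 r) (z k)" by auto
      then have "E.app c x = E.app (pCons 0 (c * r)) (z k)" by (simp flip: E.app_mult)
      then show "E.app c x \<in> range (\<lambda>r. E.app (pCons 0 r) (z k))" by blast
    qed
  qed
  ultimately obtain r where r: "z k = E.app (pCons 0 r) (z k)" by blast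
  let ?f = "1 - pCons 0 r"
  have "E.app (?f * [:0, 1:]) (v k) = E.app ?f (z k)"
    unfolding E.app_mult by (simp add: E.app_pCons z_def flip: one_pCons)
  also have "\<dots> = 0" using r by (simp add: E.app_diff)
  finally have "E.app (?f * [:0, 1:]) (v k) = 0" .
  moreover have "coeff ?f 0 \<noteq> 0" by simp
  then have "?f * [:0, 1:] \<noteq> 0" by (metis coeff_0 mult_eq_0_iff pCons_eq_0_iff zero_neq_one)
  ultimately have "z k = 0" unfolding z_def using E_poly_torsion zero by blast
  then show "w = 0" using zw[of k] additive.zero[OF additive.intro, of "E ^^ k"]
    by (simp add: E.power_add)
qed

section \<open>A basis element that acts with values in the kernel of E\<close>

lemma phi_mult: "\<beta> \<in> \<Delta> \<Longrightarrow> of_nat k * \<beta> \<in> \<Delta> \<and> \<phi> (of_nat k * \<beta>) = of_nat k * \<phi> \<beta>"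
  by (induction k) (simp_all add: zero phi_0 add hom algebra_simps)

text \<open>
  The coefficients of \<open>x\<^sub>\<gamma>\<close> shift the eigenvalues of \<open>T\<close> by \<open>-\<phi>(\<gamma>)\<close>. Multiples of
  \<open>\<beta>\<close> shift by arbitrarily many different amounts, but \<open>T\<close> has finitely many eigenvalues.
\<close>
lemma E_mode_zero_if_phi_nonzero:
  assumes q: "q \<noteq> 0" "\<And>v. E (T.app q v) = 0" and \<beta>: "\<beta> \<in> \<Delta>" "\<phi> \<beta> \<noteq> 0"
  shows "\<exists>\<gamma>\<in>\<Delta>. \<forall>n v. E (mode \<gamma> n v) = 0"
proof -
  let ?R = "{z. poly q z = 0}"
  have "finite ((\<lambda>(x, y). x - y) ` (?R \<times> ?R))" using poly_roots_finite[OF q(1)] by auto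
  from ex_nat_multiple_notin[OF this \<beta>(2)] obtain k :: nat
    where k: "of_nat k * \<phi> \<beta> \<notin> (\<lambda>(x, y). x - y) ` (?R \<times> ?R)" by blast
  define \<gamma> where "\<gamma> = of_nat k * \<beta>"
  have \<gamma>: "\<gamma> \<in> \<Delta>" "\<phi> \<gamma> = of_nat k * \<phi> \<beta>" using phi_mult[OF \<beta>(1)] by (auto simp: \<gamma>_def)
  define p where "p = pcompose q [:\<phi> \<gamma>, 1:]"
  have "poly p z \<noteq> 0" if "poly q z = 0" for z
  proof
    assume "poly p z = 0"
    then have "(\<phi> \<gamma> + z, z) \<in> ?R \<times> ?R" using that by (simp add: p_def poly_pcompose)
    then have "(\<phi> \<gamma> + z) - z \<in> (\<lambda>(x, y). x - y) ` (?R \<times> ?R)" by (rule rev_image_eqI) simp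
    with k \<gamma> show False by simp
  qed
  from bezout_complex_poly[OF q(1) this] obtain s t where st: "s * q + t * p = 1" by blast
  have "E (mode \<gamma> n v) = 0" for n v
  proof -
    let ?X = "\<lambda>v. E (mode \<gamma> n v)"
    have X: "additive ?X" by unfold_locales (simp add: mode_add \<gamma> zero)
    have Xs: "?X (sc c v) = sc c (?X v)" for c v by (simp only: mode_scale \<gamma> zero)
    have shift: "T (?X v) = ?X (T v) + sc (- \<phi> \<gamma>) (?X v)" for v
      by (simp add: T_E T_mode \<gamma> mode_diff mode_scale zero C.scale_minus_left del: minus_pCons)
    have "T.app p (?X v) = ?X (T.app q v)"
      using T.app_shift[OF X Xs shift, of p v] T.pcompose_shift_cancel[of q "- \<phi> \<gamma>"]
      by (simp add: p_def)
    also have "\<dots> = 0"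
      using mode_zero_if_E_zero[OF q(2) \<gamma>(1)] by (simp add: mode_zero zero)
    finally have kp: "T.app p (?X v) \<in> {0}" by simp
    have kq: "T.app q (?X v) \<in> {0}"
    proof -
      have "T.app q (E w) = E (T.app q w)" for w
        by (induction q) (simp_all add: T.app_pCons T_E mode_add mode_scale mode_zero zero)
      then show ?thesis by (simp add: q)
    qed
    have sub: "C.subspace {0}" by (simp add: C.subspace_def)
    have closed: "T w \<in> {0}" if "w \<in> {0}" for w using that by simp
    have "?X v \<in> {0}"
      by (rule T.app_mem_coprime[OF sub closed kq kp st]) simp_all
    then show ?thesis by simp
  qed
  with \<gamma> show ?thesis by blast
qed

lemma range_E_power_mono: "range (E ^^ Suc l) \<subseteq> range (E ^^ l)"
  by (auto simp: funpow_Suc_right simp del: funpow.simps)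

lemma range_E_power_E: "v \<in> range (E ^^ l) \<Longrightarrow> E v \<in> range (E ^^ Suc l)"
  by (auto intro: range_eqI)

text \<open>
  The coefficient \<open>x\<^bsub>\<beta>,n\<^esub>\<close> shifts the weights of \<open>H\<close> by \<open>\<beta> + b - n b\<close>. So the image
  under \<open>E x\<^bsub>\<beta>,n\<^esub>\<close> of a lowest weight \<open>x\<close> has weight \<open>x + \<beta> + 2 b - n b\<close>, whereas
  modulo \<open>range (E\<^bsup>l+2\<^esup>)\<close> the weights on \<open>range (E\<^bsup>l+1\<^esup>)\<close> are \<open>y + l b\<close>. If these never
  agree, then a value in \<open>range (E\<^bsup>l+1\<^esup>)\<close> lies already in \<open>range (E\<^bsup>l+2\<^esup>)\<close>. The
  coefficients commute with \<open>E\<close> only up to those of smaller index, which the outer induction, on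
  \<open>n\<close> and for all \<open>l\<close>, takes care of.
\<close>
lemma E_mode_E_in_E_powers:
  assumes h: "h \<noteq> 0" "\<And>v. \<exists>w. H.app h (E v) = E (E w)"
    and \<beta>: "\<beta> \<in> \<Delta>" "\<phi> \<beta> = 0"
    and avoid: "\<And>x y N. poly h x = 0 \<Longrightarrow> poly h y = 0 \<Longrightarrow> x - y + \<beta> + 2 * b \<noteq> of_nat N * b"
  shows "E (mode \<beta> n (E v)) \<in> range (E ^^ Suc l)"
proof (induction n arbitrary: l v rule: less_induct)
  case (less n)
  show ?case
  proof (induction l arbitrary: v)
    case 0
    then show ?case by simp
  next
    case (Suc l)
    let ?U = "range (E ^^ Suc (Suc l))" and ?X = "\<lambda>v. E (mode \<beta> n v)"
    define c where "c = \<beta> + 2 * b - of_nat n * b"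
    define p1 where "p1 = pcompose h [:- (of_nat l * b), 1:]"
    define p2 where "p2 = pcompose h [:- c, 1:]"
    \<comment> \<open>The vector as an element of \<open>range (E\<^bsup>l+1\<^esup>)\<close>: \<open>E\<^sup>l\<close> raises weights by \<open>l b\<close>.\<close>
    obtain u where u: "?X (E v) = (E ^^ l) (E u)"
      using Suc.IH[of v] by (auto simp: funpow_Suc_right simp del: funpow.simps)
    have add_l: "additive (E ^^ l)" by unfold_locales (rule E.power_add)
    obtain w where w: "H.app h (E u) = E (E w)" using h by blast
    have "H.app p1 (?X (E v)) = (E ^^ l) (H.app h (E u))"
      using H.app_shift[OF add_l E.power_scale H_E_power, of p1 "E u"]
      by (simp only: u p1_def H.pcompose_shift_cancel)
    also have "\<dots> \<in> ?U" unfolding w by (auto simp: funpow_Suc_right simp del: funpow.simps)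
    finally have 1: "H.app p1 (?X (E v)) \<in> ?U" .
    have X: "additive ?X" by unfold_locales (simp add: mode_add \<beta> zero)
    have Xs: "?X (sc c v) = sc c (?X v)" for c v by (simp only: mode_scale \<beta> zero)
    have shift: "H (?X v) = ?X (H v) + sc c (?X v)" for v
    proof -
      have "H (?X v) = ?X (H v) + (sc (\<beta> + b - of_nat n * b) (?X v) + sc b (?X v))"
        by (simp add: H_E H_mode \<beta> mode_add mode_scale zero)
      then show ?thesis by (simp add: c_def algebra_simps flip: C.scale_left_distrib)
    qed
    \<comment> \<open>The same vector, seen as the image of \<open>E v\<close> under an operator that raises weights by \<open>c\<close>.\<close>
    obtain w' where w': "H.app h (E v) = E (E w')" using h by blast
    have "H.app p2 (?X (E v)) = ?X (E (E w'))"
      using H.app_shift[OF X Xs shift, of p2 "E v"]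
      by (simp only: w' p2_def H.pcompose_shift_cancel)
    also have "\<dots> = E (?X (E w')) + (case n of 0 \<Rightarrow> 0 | Suc m \<Rightarrow> sc b (E (mode \<beta> m (E w'))))"
      using E_mode[OF \<beta>(1), of n "E w'"] \<beta>(2)
      by (simp add: mode_diff mode_scale mode_add zero split: nat.splits)
    also have "\<dots> \<in> ?U"
    proof (rule C.subspace_add[OF range_E_power_subspace range_E_power_E[OF Suc.IH]])
      show "(case n of 0 \<Rightarrow> 0 | Suc m \<Rightarrow> sc b (E (mode \<beta> m (E w')))) \<in> ?U"
        using less.IH C.subspace_scale[OF range_E_power_subspace] C.subspace_0[OF range_E_power_subspace]
        by (cases n) (simp_all del: funpow.simps)
    qed
    finally have 2: "H.app p2 (?X (E v)) \<in> ?U" .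
    have p1: "p1 \<noteq> 0" using h(1) by (simp add: p1_def pcompose_eq_0_iff)
    have "poly p2 z \<noteq> 0" if "poly p1 z = 0" for z
    proof
      assume "poly p2 z = 0"
      then have "poly h (z - c) = 0" "poly h (z - of_nat l * b) = 0"
        using that by (simp_all add: p1_def p2_def poly_pcompose)
      from avoid[OF this, of "n + l"] show False
        by (simp add: c_def algebra_simps)
    qed
    from bezout_complex_poly[OF p1 this] obtain s t where "s * p1 + t * p2 = 1" by blast
    from H.app_mem_coprime[OF range_E_power_subspace H_range_E_power 1 2 this] show ?case .
  qed
qed

text \<open>
  The weight conditions are met by a suitable multiple \<open>\<gamma>\<close> of \<open>\<beta>\<close> with positive or negative
  sign. Then the values \<open>E x\<^bsub>\<gamma>,n\<^esub> E v\<close> are divisible by all powers of \<open>E\<close>, hence zero, and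
  the remaining \<open>E\<close> on the right is removed by descent in \<open>n\<close>.
\<close>
lemma E_mode_zero_if_phi_zero:
  assumes B1: "finite B1" "range E \<subseteq> E.poly.span B1"
    and h: "h \<noteq> 0" "\<And>v. \<exists>w. H.app h (E v) = E (E w)"
    and \<phi>: "\<And>\<beta>. \<beta> \<in> \<Delta> \<Longrightarrow> \<phi> \<beta> = 0" and \<beta>: "\<beta> \<in> \<Delta>" "\<beta> \<noteq> 0"
  shows "\<exists>\<gamma>\<in>\<Delta>. \<forall>n v. E (mode \<gamma> n v) = 0"
proof -
  let ?R = "{z. poly h z = 0}"
  let ?S = "(\<lambda>(x, y). (y - x) / b - 2) ` (?R \<times> ?R)"
  have "finite ?S" using poly_roots_finite[OF h(1)] by auto
  moreover have "\<beta> / b \<noteq> 0" using \<beta> b_nz by simp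
  ultimately obtain k :: nat and s where s: "s \<in> {1, -1}"
    and ks: "\<And>d N. d \<in> ?S \<Longrightarrow> of_nat k * (s * (\<beta> / b)) \<noteq> d + of_nat N"
    using ex_multiple_avoiding_cones[of ?S "\<beta> / b"] by blast
  define \<gamma> where "\<gamma> = of_nat k * (s * \<beta>)"
  have "s * \<beta> \<in> \<Delta>" using s \<beta> neg by auto
  then have \<gamma>: "\<gamma> \<in> \<Delta>" "\<phi> \<gamma> = 0" using phi_mult[of "s * \<beta>" k] \<phi> by (auto simp: \<gamma>_def)
  have avoid: "x - y + \<gamma> + 2 * b \<noteq> of_nat N * b" if "poly h x = 0" "poly h y = 0" for x y N
  proof
    assume "x - y + \<gamma> + 2 * b = of_nat N * b"
    then have "\<gamma> / b = (y - x) / b - 2 + of_nat N" using b_nz by (simp add: field_simps)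
    moreover have "(y - x) / b - 2 \<in> ?S" using that by (intro rev_image_eqI[of "(x, y)"]) auto
    ultimately show False using ks[of "(y - x) / b - 2" N] by (simp add: \<gamma>_def)
  qed
  have "E (mode \<gamma> n (E v)) \<in> range (E ^^ l)" for n v l
    using E_mode_E_in_E_powers[OF h \<gamma> avoid, of n v l] range_E_power_mono by blast
  then have E0: "E (mode \<gamma> n (E v)) = 0" for n v
    by (rule E_adic_separated[OF B1])
  have "E (mode \<gamma> n v) = 0" for n v
  proof (rule zero_by_descent[of "\<lambda>n. E (mode \<gamma> n v)"])
    show "\<exists>N. \<forall>n>N. E (mode \<gamma> n v) = 0"
      using mode_eventually_0[of \<gamma> v] by (metis mode_zero zero)
  next
    fix n assume "E (mode \<gamma> (Suc n) v) = 0"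
    with E_mode[OF \<gamma>(1), of "Suc n" v] have "mode \<gamma> (Suc n) (E v) = sc b (mode \<gamma> n v)"
      by (simp add: \<gamma>)
    with E0[of "Suc n" v] have "sc b (E (mode \<gamma> n v)) = 0" by (simp add: mode_scale zero)
    then have "sc (inverse b) (sc b (E (mode \<gamma> n v))) = 0" by simp
    then show "E (mode \<gamma> n v) = 0" using b_nz by (simp add: one_pCons[symmetric])
  qed
  with \<gamma> show ?thesis by blast
qed

text \<open>
  One basis element that acts trivially modulo the kernel of \<open>E\<close> suffices: bracketing it with
  \<open>x\<^bsub>-\<beta>\<^esub>\<close> shows the same for \<open>x\<^sub>0\<close>. The leading coefficient of this bracket is
  \<open>b - \<beta>\<close>, which is nonzero because \<open>2 b \<notin> \<Delta>\<close>. For \<open>x\<^sub>0\<close> itself the claim contains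
  \<open>E\<^sup>2 = 0\<close>, and the module is torsion over \<open>\<complex>[E]\<close>.
\<close>
lemma mode_zero_if_E_mode_zero:
  assumes \<beta>: "\<beta> \<in> \<Delta>" and E0: "\<And>n v. E (mode \<beta> n v) = 0" and \<gamma>: "\<gamma> \<in> \<Delta>"
  shows "mode \<gamma> n v = 0"
proof (rule mode_zero_if_E_zero[OF _ \<gamma>], rule E_E_zero)
  let ?\<alpha> = "- \<beta>"
  have \<alpha>: "?\<alpha> \<in> \<Delta>" using neg \<beta> by blast
  have "b \<notin> \<Delta>"
  proof
    assume "b \<in> \<Delta>"
    from add[OF this this] b show False by (metis mult_2)
  qed
  with \<beta> have nz: "?\<alpha> + b \<noteq> 0" by (auto simp: add_eq_0_iff)
  have "E (mode 0 n v) = 0" for n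
  proof (rule zero_by_descent[of "\<lambda>n. E (mode 0 n v)"])
    show "\<exists>N. \<forall>n>N. E (mode 0 n v) = 0"
      using mode_eventually_0[of 0 v] by (metis mode_zero zero)
  next
    fix n assume *: "E (mode 0 (Suc n) v) = 0"
    have "mode ?\<alpha> 0 (mode \<beta> (Suc n) v) = 0"
      by (rule mode_zero_if_E_zero[OF E0 \<alpha>])
    then have "mode \<beta> (Suc n) (mode ?\<alpha> 0 v) + sc (struct_const ?\<alpha> \<beta>) (mode 0 (Suc n) v)
        = sc (?\<alpha> + b) (mode 0 n v)"
      using mode_commutator_0[OF \<alpha> \<beta>, of "Suc n" v] by simp
    then have "E (sc (?\<alpha> + b) (mode 0 n v)) = 0"
      using * by (metis E0 add_0 mode_add mode_scale zero C.scale_zero_right)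
    then have "sc (inverse (?\<alpha> + b)) (sc (?\<alpha> + b) (E (mode 0 n v))) = 0"
      by (simp only: mode_scale zero C.scale_zero_right)
    then show "E (mode 0 n v) = 0" using nz by (simp add: one_pCons[symmetric])
  qed
  then show "E (E v) = 0" by simp
qed

lemma act_eq_zero:
  assumes "\<And>\<alpha> n v. \<alpha> \<in> \<Delta> \<Longrightarrow> mode \<alpha> n v = 0" and a: "a \<in> CL_carrier \<Delta>"
  shows "act a v = 0"
proof -
  have single: "act (Poly_Mapping.single \<alpha> p) v = 0" if "\<alpha> \<in> \<Delta>" for \<alpha> p
    by (rule poly_eqI) (simp add: act_single_partial that assms(1))
  have "act (\<Sum>\<alpha>\<in>A. Poly_Mapping.single \<alpha> (f \<alpha>)) v = 0" if "finite A" "A \<subseteq> \<Delta>" for A f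
    using that
  proof (induction A)
    case (insert \<alpha> A)
    have "(\<Sum>\<alpha>\<in>A. Poly_Mapping.single \<alpha> (f \<alpha>)) \<in> CL_carrier \<Delta>"
      using insert.prems by (intro subspace_sum[OF submodule] single_carrier) auto
    then show ?case using insert by (simp add: act_add_left single_carrier single)
  qed (simp add: act_zero_left)
  moreover have "a = (\<Sum>\<alpha>\<in>Poly_Mapping.keys a. Poly_Mapping.single \<alpha> (Poly_Mapping.lookup a \<alpha>))"
    by (intro poly_mapping_eqI) (auto simp: lookup_sum lookup_single when_def in_keys_iff)
  ultimately show ?thesis using a by (metis CL_carrier_def finite_keys mem_Collect_eq)
qed

end

section \<open>Representations on finitely generated modules\<close>

theorem theorem5p3:
  fixes \<Delta> :: "complex set" and b :: complex and \<phi> :: "complex \<Rightarrow> complex"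
    and scaleV :: "complex poly \<Rightarrow> 'v::ab_group_add \<Rightarrow> 'v"
    and act :: "cl \<Rightarrow> 'v \<Rightarrow> 'v poly"
  assumes zero: "0 \<in> \<Delta>"
    and add: "\<And>\<alpha> \<beta>. \<alpha> \<in> \<Delta> \<Longrightarrow> \<beta> \<in> \<Delta> \<Longrightarrow> \<alpha> + \<beta> \<in> \<Delta>"
    and neg: "\<And>\<alpha>. \<alpha> \<in> \<Delta> \<Longrightarrow> - \<alpha> \<in> \<Delta>"
    and inf: "infinite \<Delta>"
    and b: "2 * b \<notin> \<Delta>"
    and hom: "\<And>\<alpha> \<beta>. \<alpha> \<in> \<Delta> \<Longrightarrow> \<beta> \<in> \<Delta> \<Longrightarrow> \<phi> (\<alpha> + \<beta>) = \<phi> \<alpha> + \<phi> \<beta>"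
    and rep: "lie_conformal_module CL_scale (CL_carrier \<Delta>) (CL_bracket b \<phi>) scaleV act"
    and fin: "\<exists>B. finite B \<and> module.span scaleV B = UNIV"
  shows "\<forall>a \<in> CL_carrier \<Delta>. \<forall>v. act a v = 0"
proof -
  interpret lie_conformal_module CL_scale "CL_carrier \<Delta>" "CL_bracket b \<phi>" scaleV act
    by (rule rep)
  interpret CL_module \<Delta> b \<phi> scaleV act
    by unfold_locales (fact zero add neg b hom)+
  obtain B where B: "finite B" "V.span B = UNIV" using fin by blast
  obtain q where q: "q \<noteq> 0" "\<And>v. E (T.app q v) = 0" using ex_poly_T[OF B] by blast
  have "\<exists>\<gamma>\<in>\<Delta>. \<forall>n v. E (mode \<gamma> n v) = 0"
  proof (cases "\<exists>\<beta>\<in>\<Delta>. \<phi> \<beta> \<noteq> 0")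
    case True
    then show ?thesis using E_mode_zero_if_phi_nonzero[OF q] by blast
  next
    case False
    obtain B1 where B1: "finite B1" "B1 \<subseteq> range E" "range E \<subseteq> E.poly.span B1"
      using range_E_fin_gen[OF B q] by blast
    obtain h where h: "h \<noteq> 0" "\<And>v. \<exists>w. H.app h (E v) = E (E w)"
      using ex_poly_H[OF B1] by blast
    have "\<not> \<Delta> \<subseteq> {0}" using inf finite_subset by blast
    then obtain \<beta> where "\<beta> \<in> \<Delta>" "\<beta> \<noteq> 0" by blast
    then show ?thesis using E_mode_zero_if_phi_zero[OF B1(1,3) h] False by blast
  qed
  then show ?thesis using act_eq_zero mode_zero_if_E_mode_zero by blast
qed

end
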